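(* There exist valued fields $(K,v)$ such that: the value group $vK$ has no maximal proper convex subgroup; for every non-trivial coarsening $w\neq v$ of $v$ the valued residue field $(Kw,\overline{w})$ is henselian; but $(K,v)$ itself is not henselian.
   Context: Valuations are Krull valuations (arbitrary ordered abelian value groups); equivalent valuations are identified. A valuation $w$ on $K$ is a coarsening of $v$ if the valuation ring of $w$ contains the valuation ring of $v$. In this case $v$ induces a valuation $\overline{w}$ on the residue field $Kw$ of $w$, namely the valuation whose valuation ring is the image of the valuation ring of $v$ under the residue map associated with $w$. *)

theory Defs
  imports Complex_Main "HOL-Algebra.Algebra"
begin

section \<open>Ordered abelian groups and convex subgroups\<close>

text \<open>
  Ordered groups are written multiplicatively, as in HOL-Algebra; the order is the one of the
  additive convention, so that the elements of a valuation ring are those with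
  \<open>\<one> \<preceq> v x\<close>.
\<close>

record 'g ordered_group = "'g monoid" +
  preceq :: "['g, 'g] \<Rightarrow> bool" (infixl \<open>\<preceq>\<index>\<close> 50)

locale ordered_abelian_group = comm_group G
  for G :: "('g, 'b) ordered_group_scheme" (structure) +
  assumes preceq_antisym:
      "\<lbrakk>x \<in> carrier G; y \<in> carrier G; x \<preceq> y; y \<preceq> x\<rbrakk> \<Longrightarrow> x = y"
    and preceq_trans:
      "\<lbrakk>x \<in> carrier G; y \<in> carrier G; z \<in> carrier G; x \<preceq> y; y \<preceq> z\<rbrakk> \<Longrightarrow> x \<preceq> z"
    and preceq_total:
      "\<lbrakk>x \<in> carrier G; y \<in> carrier G\<rbrakk> \<Longrightarrow> x \<preceq> y \<or> y \<preceq> x"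
    and preceq_mult:
      "\<lbrakk>x \<in> carrier G; y \<in> carrier G; z \<in> carrier G; x \<preceq> y\<rbrakk> \<Longrightarrow> x \<otimes> z \<preceq> y \<otimes> z"

definition convex_subgroup :: "'g set \<Rightarrow> ('g, 'b) ordered_group_scheme \<Rightarrow> bool" where
  "convex_subgroup H G \<longleftrightarrow> subgroup H G \<and>
     (\<forall>a\<in>H. \<forall>b\<in>H. \<forall>x\<in>carrier G. a \<preceq>\<^bsub>G\<^esub> x \<and> x \<preceq>\<^bsub>G\<^esub> b \<longrightarrow> x \<in> H)"

definition maximal_proper_convex_subgroup ::
    "'g set \<Rightarrow> ('g, 'b) ordered_group_scheme \<Rightarrow> bool" where
  "maximal_proper_convex_subgroup H G \<longleftrightarrow>
     convex_subgroup H G \<and> H \<noteq> carrier G \<and>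
     (\<forall>H'. convex_subgroup H' G \<and> H' \<noteq> carrier G \<and> H \<subseteq> H' \<longrightarrow> H' = H)"


section \<open>Krull valuations\<close>

text \<open>
  A valuation consists of an ordered abelian group together with the map \<open>val\<close>.  Only the values
  of \<open>val\<close> at non-zero elements matter: the convention \<open>v 0 = \<infinity>\<close> is built into the definitions
  below by treating \<open>\<zero>\<close> separately.
\<close>

record ('a, 'g) valuation = "'g ordered_group" +
  val :: "'a \<Rightarrow> 'g"

locale valued_field = field K + vgroup: ordered_abelian_group v
  for K :: "('a, 'b) ring_scheme" (structure)
    and v :: "('a, 'g, 'c) valuation_scheme" +
  assumes val_hom: "val v \<in> hom (units_of K) v"
    and val_add: "\<lbrakk>x \<in> carrier K - {\<zero>}; y \<in> carrier K - {\<zero>}; x \<oplus> y \<noteq> \<zero>\<rbrakk>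
      \<Longrightarrow> val v x \<preceq>\<^bsub>v\<^esub> val v (x \<oplus> y) \<or> val v y \<preceq>\<^bsub>v\<^esub> val v (x \<oplus> y)"

definition value_group ::
    "('a, 'b) ring_scheme \<Rightarrow> ('a, 'g) valuation \<Rightarrow> ('a, 'g) valuation" where
  "value_group K v = v\<lparr>carrier := val v ` (carrier K - {\<zero>\<^bsub>K\<^esub>})\<rparr>"

definition valuation_ring ::
    "('a, 'b) ring_scheme \<Rightarrow> ('a, 'g, 'c) valuation_scheme \<Rightarrow> 'a set" where
  "valuation_ring K v = {x \<in> carrier K. x = \<zero>\<^bsub>K\<^esub> \<or> \<one>\<^bsub>v\<^esub> \<preceq>\<^bsub>v\<^esub> val v x}"

definition valuation_ideal ::
    "('a, 'b) ring_scheme \<Rightarrow> ('a, 'g, 'c) valuation_scheme \<Rightarrow> 'a set" where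
  "valuation_ideal K v =
     {x \<in> carrier K. x = \<zero>\<^bsub>K\<^esub> \<or> (\<one>\<^bsub>v\<^esub> \<preceq>\<^bsub>v\<^esub> val v x \<and> val v x \<noteq> \<one>\<^bsub>v\<^esub>)}"

definition trivial_valuation ::
    "('a, 'b) ring_scheme \<Rightarrow> ('a, 'g, 'c) valuation_scheme \<Rightarrow> bool" where
  "trivial_valuation K v \<longleftrightarrow> (\<forall>x \<in> carrier K - {\<zero>\<^bsub>K\<^esub>}. val v x = \<one>\<^bsub>v\<^esub>)"

text \<open>Equality of valuations in the sense that equivalent valuations are identified.\<close>

definition equivalent_valuations :: "('a, 'b) ring_scheme \<Rightarrow>
    ('a, 'g, 'c) valuation_scheme \<Rightarrow> ('a, 'h, 'd) valuation_scheme \<Rightarrow> bool" where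
  "equivalent_valuations K v w \<longleftrightarrow>
     (\<forall>x \<in> carrier K - {\<zero>\<^bsub>K\<^esub>}. \<forall>y \<in> carrier K - {\<zero>\<^bsub>K\<^esub>}.
        val v x \<preceq>\<^bsub>v\<^esub> val v y \<longleftrightarrow> val w x \<preceq>\<^bsub>w\<^esub> val w y)"

definition coarsening :: "('a, 'b) ring_scheme \<Rightarrow>
    ('a, 'g, 'c) valuation_scheme \<Rightarrow> ('a, 'h, 'd) valuation_scheme \<Rightarrow> bool" where
  "coarsening K v w \<longleftrightarrow> valued_field K w \<and> valuation_ring K v \<subseteq> valuation_ring K w"


section \<open>The valuation of a valuation ring\<close>

definition ring_units :: "('a, 'b) ring_scheme \<Rightarrow> 'a set \<Rightarrow> 'a set" where
  "ring_units K A = {x \<in> A - {\<zero>\<^bsub>K\<^esub>}. inv\<^bsub>K\<^esub> x \<in> A}"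

text \<open>
  The canonical valuation \<open>K\<^sup>\<times> \<rightarrow> K\<^sup>\<times> / A\<^sup>\<times>\<close> belonging to a valuation ring \<open>A\<close> of \<open>K\<close>.  Every
  valuation \<open>v\<close> of \<open>K\<close> is equivalent to \<open>valuation_of_ring K (valuation_ring K v)\<close>; hence, up to
  equivalence, all valuations of a field with elements in \<open>'a\<close> take values in \<open>'a set\<close>.
\<close>

definition valuation_of_ring ::
    "('a, 'b) ring_scheme \<Rightarrow> 'a set \<Rightarrow> ('a, 'a set) valuation" where
  "valuation_of_ring K A =
     \<lparr>carrier = carrier (units_of K Mod ring_units K A),
      monoid.mult = monoid.mult (units_of K Mod ring_units K A),
      one = one (units_of K Mod ring_units K A),
      preceq = (\<lambda>S T. \<exists>x\<in>S. \<exists>y\<in>T. y \<otimes>\<^bsub>K\<^esub> inv\<^bsub>K\<^esub> x \<in> A),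
      val = (\<lambda>x. ring_units K A #>\<^bsub>units_of K\<^esub> x)\<rparr>"


section \<open>Residue fields\<close>

definition residue_field ::
    "('a, 'b) ring_scheme \<Rightarrow> ('a, 'g, 'c) valuation_scheme \<Rightarrow> 'a set ring" where
  "residue_field K v = K\<lparr>carrier := valuation_ring K v\<rparr> Quot valuation_ideal K v"

definition residue_map ::
    "('a, 'b) ring_scheme \<Rightarrow> ('a, 'g, 'c) valuation_scheme \<Rightarrow> 'a \<Rightarrow> 'a set" where
  "residue_map K v x = valuation_ideal K v +>\<^bsub>K\<lparr>carrier := valuation_ring K v\<rparr>\<^esub> x"

text \<open>The valuation that \<open>v\<close> induces on the residue field of a coarsening \<open>w\<close> of \<open>v\<close>.\<close>

definition residue_valuation :: "('a, 'b) ring_scheme \<Rightarrow>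
    ('a, 'g, 'c) valuation_scheme \<Rightarrow> ('a, 'h, 'd) valuation_scheme \<Rightarrow>
    ('a set, 'a set set) valuation" where
  "residue_valuation K v w =
     valuation_of_ring (residue_field K w) (residue_map K w ` valuation_ring K v)"


section \<open>Henselian valued fields\<close>

text \<open>
  Polynomials are coefficient lists with the leading coefficient first, as in
  \<^theory>\<open>HOL-Algebra.Polynomials\<close>.  The derivative need not be normalized (its first entry may be
  zero in positive characteristic); it is only used for evaluation.
\<close>

fun formal_deriv :: "('a, 'b) ring_scheme \<Rightarrow> 'a list \<Rightarrow> 'a list" where
  "formal_deriv K [] = []"
| "formal_deriv K [c] = []"
| "formal_deriv K (c # d # cs) =
     ([length (d # cs)] \<cdot>\<^bsub>K\<^esub> c) # formal_deriv K (d # cs)"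

definition henselian ::
    "('a, 'b) ring_scheme \<Rightarrow> ('a, 'g, 'c) valuation_scheme \<Rightarrow> bool" where
  "henselian K v \<longleftrightarrow> valued_field K v \<and>
     (\<forall>f \<in> carrier (univ_poly K (valuation_ring K v)). \<forall>a \<in> valuation_ring K v.
        ring.eval K f a \<in> valuation_ideal K v \<and>
        ring.eval K (formal_deriv K f) a \<notin> valuation_ideal K v \<longrightarrow>
        (\<exists>b \<in> valuation_ring K v.
           ring.eval K f b = \<zero>\<^bsub>K\<^esub> \<and> b \<ominus>\<^bsub>K\<^esub> a \<in> valuation_ideal K v))"

end

theory Submission
  imports Defs "HOL-Computational_Algebra.Fundamental_Theorem_Algebra"
begin

text \<open>
  The example is a rational function field \<open>K = L(y)\<close>.  Here \<open>L\<close> is the union of a tower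
  \<open>L\<^sub>0 \<subseteq> L\<^sub>1 \<subseteq> \<dots>\<close> of algebraically closed fields inside a valued field with valuation ring \<open>V\<close>, and
  \<open>t\<^sub>n \<in> L\<^sub>n\<^sub>+\<^sub>1\<close> has a value larger than those of all
  non-zero elements of \<open>L\<^sub>n\<close>.  The element \<open>y\<close> is a limit of the partial
  sums of \<open>\<Sum>t\<^sub>i\<close>, and \<open>v\<close> is the restriction to \<open>K\<close> of the ambient valuation.

  \<^item> The values \<open>v t\<^sub>n\<close> are cofinal in \<open>vK\<close> (\<open>K_bounded_below\<close>).  A proper convex subgroup therefore
    misses some \<open>v t\<^sub>n\<close>, so it lies in the convex hull of \<open>vL\<^sub>n\<^sub>+\<^sub>1\<close>.  This hull contains \<open>v t\<^sub>n\<close> but not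
    \<open>v t\<^sub>n\<^sub>+\<^sub>1\<close>, hence is proper and strictly larger (\<open>no_maximal_proper_convex_subgroup\<close>).

  \<^item> No element of \<open>L\<close> is a limit of the partial sums: \<open>a \<in> L\<^sub>m\<close> differs from \<open>y\<close> by an element of
    \<open>L\<^sub>m\<close> plus approximately \<open>t\<^sub>m\<close> (\<open>y_diff_bounded_below\<close>).  As polynomials over \<open>L\<close> split into
    linear factors, \<open>y\<close> is transcendental over \<open>L\<close> and \<open>L\<close> is dense in \<open>K\<close>
    (\<open>poly_y_bounded_below\<close>, \<open>K_approximable\<close>).

  \<^item> The maximal ideal of a non-trivial coarsening \<open>w\<close> contains some \<open>t\<^sub>n V \<inter> K\<close>, so by density the
    image of \<open>V \<inter> K\<close> in \<open>Kw\<close> is already the image of \<open>V \<inter> L\<close>.  A polynomial over this image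
    lifts to \<open>V \<inter> L\<close> and splits over \<open>L\<close>; and among the roots of a split polynomial there
    is one near each approximate simple root, because otherwise the logarithmic derivative
    \<open>p'/p = \<Sum>1/(a - x)\<close> would be integral (\<open>hensel_root_near\<close>, \<open>residue_field_henselian\<close>).

  \<^item> Modulo the maximal ideal, \<open>0\<close> is a simple root of \<open>X\<^sup>2 + X - y\<close>; this polynomial has no
    root in the rational function field \<open>L(y)\<close> for reasons of degree (\<open>no_artin_schreier_root\<close>,
    \<open>not_henselian\<close>).

  The ambient valued field is an ultrapower of the complex numbers with the ring of bounded elements
  as valuation ring.  It is algebraically closed, and countable saturation yields both the elements
  \<open>t\<^sub>n\<close> (\<open>finite_hyper_scale\<close>) and the limit \<open>y\<close> (\<open>finite_hyper_pseudo_limit\<close>).  All \<open>L\<^sub>n\<close> can be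
  taken countable, so \<open>K\<close> is countable and its field structure can be carried over to a set of
  complex numbers.
\<close>

section \<open>An ultrapower of the complex numbers\<close>

text \<open>
  Zorn's lemma for proper filters below \<open>F\<close>: a minimal one decides every predicate \<open>P\<close>, because
  restricting it to \<open>P\<close> gives either the improper filter or the same filter again.
\<close>

lemma ultrafilter_below:
  fixes F :: "'a filter"
  assumes "F \<noteq> bot"
  shows "\<exists>U\<le>F. U \<noteq> bot \<and> (\<forall>P. eventually P U \<or> eventually (\<lambda>x. \<not> P x) U)"
proof -
  define \<F> where "\<F> = {G. G \<noteq> bot \<and> G \<le> F}"
  have "\<exists>U\<in>\<F>. \<forall>G\<in>\<F>. G \<le> U \<longrightarrow> G = U"
  proof (rule predicate_Zorn)
    show "partial_order_on \<F> (relation_of (\<lambda>G H. H \<le> G) \<F>)"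
      by (auto simp: partial_order_on_def preorder_on_def refl_on_def trans_def antisym_def
          relation_of_def)
  next
    fix C assume "C \<in> Chains (relation_of (\<lambda>G H. H \<le> G) \<F>)"
    then have C: "G \<in> \<F>" "G \<le> H \<or> H \<le> G" if "G \<in> C" "H \<in> C" for G H
      using that by (auto simp: Chains_def relation_of_def)
    show "\<exists>u\<in>\<F>. \<forall>G\<in>C. u \<le> G"
    proof (cases "C = {}")
      case True
      then show ?thesis using assms by (auto simp: \<F>_def)
    next
      case False
      have "\<exists>H\<in>C. H \<le> inf G G'" if "G \<in> C" "G' \<in> C" for G G'
        using C(2)[OF that] that by (metis inf.absorb1 inf.absorb2 order_refl)
      then have "eventually (\<lambda>x. False) (Inf C) \<longleftrightarrow> (\<exists>G\<in>C. eventually (\<lambda>x. False) G)"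
        using False by (intro eventually_Inf_base) auto
      then have "Inf C \<noteq> bot"
        using C(1) by (auto simp: \<F>_def trivial_limit_def)
      moreover have "Inf C \<le> F"
        using False C(1) by (auto simp: \<F>_def intro: Inf_lower2)
      ultimately show ?thesis
        by (auto simp: \<F>_def intro!: bexI[of _ "Inf C"] Inf_lower)
    qed
  qed
  then obtain U where U: "U \<noteq> bot" "U \<le> F" and min: "\<And>G. G \<noteq> bot \<Longrightarrow> G \<le> U \<Longrightarrow> G = U"
    unfolding \<F>_def using order_trans by blast
  have "eventually P U \<or> eventually (\<lambda>x. \<not> P x) U" for P
  proof (cases "inf U (principal {x. P x}) = bot")
    case True
    then show ?thesis
      by (simp add: trivial_limit_def eventually_inf_principal)
  next
    case False
    then have eq: "inf U (principal {x. P x}) = U" by (intro min) auto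
    have "eventually P (inf U (principal {x. P x}))" by (simp add: eventually_inf_principal)
    then show ?thesis unfolding eq ..
  qed
  with U show ?thesis by blast
qed

text \<open>
  Any non-principal ultrafilter on the natural numbers serves; it is fixed once and for all so that
  the ultrapower can be a type.
\<close>

definition nat_ultrafilter :: "nat filter" where
  "nat_ultrafilter = (SOME U. U \<le> sequentially \<and> U \<noteq> bot \<and>
     (\<forall>P. eventually P U \<or> eventually (\<lambda>x. \<not> P x) U))"

lemma nat_ultrafilter:
  shows nat_ultrafilter_le: "nat_ultrafilter \<le> sequentially"
    and nat_ultrafilter_not_bot: "nat_ultrafilter \<noteq> bot"
    and nat_ultrafilter_decides:
      "eventually P nat_ultrafilter \<or> eventually (\<lambda>x. \<not> P x) nat_ultrafilter"
proof -
  have "\<exists>U. U \<le> sequentially \<and> U \<noteq> bot \<and>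
     (\<forall>P. eventually P U \<or> eventually (\<lambda>x. \<not> P x) U)"
    using ultrafilter_below[of "sequentially", OF sequentially_bot]
    by (elim exE conjE) (intro exI conjI)
  from someI_ex[OF this, folded nat_ultrafilter_def]
  have *: "nat_ultrafilter \<le> sequentially \<and> nat_ultrafilter \<noteq> bot \<and>
    (\<forall>P. eventually P nat_ultrafilter \<or> eventually (\<lambda>x. \<not> P x) nat_ultrafilter)" .
  show "nat_ultrafilter \<le> sequentially"
    by (rule *[THEN conjunct1])
  show "nat_ultrafilter \<noteq> bot"
    by (rule *[THEN conjunct2, THEN conjunct1])
  show "eventually P nat_ultrafilter \<or> eventually (\<lambda>x. \<not> P x) nat_ultrafilter"
    by (rule *[THEN conjunct2, THEN conjunct2, THEN spec])
qed

lemma eventually_nat_ultrafilter_ge: "eventually (\<lambda>n. k \<le> n) nat_ultrafilter"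
  by (rule filter_leD[OF nat_ultrafilter_le eventually_ge_at_top])

lemma not_eventually_nat_ultrafilter:
  "\<not> eventually P nat_ultrafilter \<longleftrightarrow> eventually (\<lambda>x. \<not> P x) nat_ultrafilter"
proof
  assume neg: "eventually (\<lambda>x. \<not> P x) nat_ultrafilter"
  show "\<not> eventually P nat_ultrafilter"
  proof
    assume "eventually P nat_ultrafilter"
    with neg have "eventually (\<lambda>x. False) nat_ultrafilter" by eventually_elim simp
    with nat_ultrafilter_not_bot show False by (simp add: trivial_limit_def)
  qed
next
  assume "\<not> eventually P nat_ultrafilter"
  with nat_ultrafilter_decides[of P] show "eventually (\<lambda>x. \<not> P x) nat_ultrafilter"
    by (rule disjE[OF _ notE])
qed

quotient_type hyper = "nat \<Rightarrow> complex" /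
  "\<lambda>f g. eventually (\<lambda>n. f n = g n) nat_ultrafilter"
proof (rule equivpI)
  show "reflp (\<lambda>f g. eventually (\<lambda>n. f n = (g n :: complex)) nat_ultrafilter)"
    by (auto intro: reflpI)
  show "symp (\<lambda>f g. eventually (\<lambda>n. f n = (g n :: complex)) nat_ultrafilter)"
    by (auto intro!: sympI elim: eventually_mono)
  show "transp (\<lambda>f g. eventually (\<lambda>n. f n = (g n :: complex)) nat_ultrafilter)"
    by (auto intro!: transpI elim: eventually_elim2)
qed

instantiation hyper :: field
begin

lift_definition zero_hyper :: hyper is "\<lambda>_. 0" .
lift_definition one_hyper :: hyper is "\<lambda>_. 1" .
lift_definition plus_hyper :: "hyper \<Rightarrow> hyper \<Rightarrow> hyper" is "\<lambda>f g n. f n + g n"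
  by (auto elim: eventually_elim2)
lift_definition minus_hyper :: "hyper \<Rightarrow> hyper \<Rightarrow> hyper" is "\<lambda>f g n. f n - g n"
  by (auto elim: eventually_elim2)
lift_definition uminus_hyper :: "hyper \<Rightarrow> hyper" is "\<lambda>f n. - f n"
  by (auto elim: eventually_mono)
lift_definition times_hyper :: "hyper \<Rightarrow> hyper \<Rightarrow> hyper" is "\<lambda>f g n. f n * g n"
  by (auto elim: eventually_elim2)
lift_definition inverse_hyper :: "hyper \<Rightarrow> hyper" is "\<lambda>f n. inverse (f n)"
  by (auto elim: eventually_mono)
lift_definition divide_hyper :: "hyper \<Rightarrow> hyper \<Rightarrow> hyper" is "\<lambda>f g n. f n / g n"
  by (auto elim: eventually_elim2)

instance
proof
  fix x y z :: hyper
  show "x * y * z = x * (y * z)" by transfer (simp add: mult.assoc)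
  show "x * y = y * x" by transfer (simp add: mult.commute)
  show "1 * x = x" by transfer simp
  show "x + y + z = x + (y + z)" by transfer (simp add: add.assoc)
  show "x + y = y + x" by transfer (simp add: add.commute)
  show "0 + x = x" by transfer simp
  show "- x + x = 0" by transfer simp
  show "x - y = x + - y" by transfer simp
  show "(x + y) * z = x * z + y * z" by transfer (simp add: algebra_simps)
  show "(0::hyper) \<noteq> 1" by transfer (use nat_ultrafilter_not_bot in \<open>simp add: trivial_limit_def\<close>)
  show "x \<noteq> 0 \<Longrightarrow> inverse x * x = 1"
    by transfer (auto simp: not_eventually_nat_ultrafilter elim: eventually_mono)
  show "x div y = x * inverse y" by transfer (simp add: divide_inverse)
  show "inverse (0::hyper) = 0" by transfer simp
qed

end

lemma abs_rep_hyper: "abs_hyper (rep_hyper x) = x"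
  by (rule Quotient_abs_rep[OF Quotient_hyper])

lemma hyper_rep: obtains f where "x = abs_hyper f"
  by (rule that[of "rep_hyper x"]) (simp add: abs_rep_hyper)

lemma power_abs_hyper: "abs_hyper f ^ k = abs_hyper (\<lambda>n. f n ^ k)"
  by (induction k) (simp_all add: one_hyper.abs_eq times_hyper.abs_eq)

lemma sum_abs_hyper: "(\<Sum>k\<le>(d::nat). abs_hyper (F k)) = abs_hyper (\<lambda>n. \<Sum>k\<le>d. F k n)"
  by (induction d) (simp_all add: plus_hyper.abs_eq)

text \<open>
  Roots can be chosen index by index; where the leading coefficient happens to vanish, the choice
  is arbitrary, which concerns only a negligible set of indices.
\<close>

instance hyper :: alg_closed_field
proof intro_classes
  fix f :: "nat \<Rightarrow> hyper" and d assume d: "d > 0" and nz: "f d \<noteq> 0"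
  define F where "F k = rep_hyper (f k)" for k
  have F: "f k = abs_hyper (F k)" for k
    unfolding F_def by (simp add: abs_rep_hyper)
  define x where "x n = (SOME x. (\<Sum>k\<le>d. F k n * x ^ k) = 0)" for n
  have "(\<Sum>k\<le>d. F k n * x n ^ k) = 0" if "F d n \<noteq> 0" for n
    unfolding x_def using alg_closed[of d "\<lambda>k. F k n"] d that by (auto intro: someI_ex)
  moreover have "eventually (\<lambda>n. F d n \<noteq> 0) nat_ultrafilter"
    using nz unfolding F zero_hyper.abs_eq hyper.abs_eq_iff not_eventually_nat_ultrafilter .
  ultimately have "eventually (\<lambda>n. (\<Sum>k\<le>d. F k n * x n ^ k) = 0) nat_ultrafilter"
    by (auto elim: eventually_mono)
  then have "(\<Sum>k\<le>d. f k * abs_hyper x ^ k) = 0"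
    unfolding F power_abs_hyper times_hyper.abs_eq sum_abs_hyper zero_hyper.abs_eq
      hyper.abs_eq_iff .
  then show "\<exists>x. (\<Sum>k\<le>d. f k * x ^ k) = 0" by blast
qed

section \<open>Valuation rings of a type\<close>

text \<open>
  Valuation rings of a field that is given as a type.  The value of \<open>x\<close> is at most that of \<open>y\<close> if and
  only if \<open>y / x \<in> V\<close>, so \<open>t / x \<in> V\<close> reads as an upper bound for the value of \<open>x\<close>.
\<close>

locale valuation_subring =
  fixes V :: "'k::field set"
  assumes one_mem: "1 \<in> V"
    and add_mem: "x \<in> V \<Longrightarrow> y \<in> V \<Longrightarrow> x + y \<in> V"
    and uminus_mem: "x \<in> V \<Longrightarrow> - x \<in> V"
    and mult_mem: "x \<in> V \<Longrightarrow> y \<in> V \<Longrightarrow> x * y \<in> V"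
    and mem_or_inverse_mem: "x \<in> V \<or> inverse x \<in> V"
begin

definition nonunits :: "'k set" where
  "nonunits = {x. x = 0 \<or> inverse x \<notin> V}"

lemma zero_mem: "0 \<in> V"
  using mem_or_inverse_mem[of 0] by simp

lemma diff_mem: "x \<in> V \<Longrightarrow> y \<in> V \<Longrightarrow> x - y \<in> V"
  using add_mem[of x "- y"] uminus_mem[of y] by simp

lemma nonunits_subset: "x \<in> nonunits \<Longrightarrow> x \<in> V"
  using mem_or_inverse_mem zero_mem by (auto simp: nonunits_def)

lemma zero_nonunit: "0 \<in> nonunits"
  by (simp add: nonunits_def)

lemma one_not_nonunit: "1 \<notin> nonunits"
  using one_mem by (simp add: nonunits_def)

lemma mult_nonunit: "x \<in> nonunits \<Longrightarrow> y \<in> V \<Longrightarrow> x * y \<in> nonunits"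
  by (cases "y = 0") (auto simp: nonunits_def field_simps dest: mult_mem[of y "inverse (x*y)"])

lemma add_nonunit: "x \<in> nonunits \<Longrightarrow> y \<in> nonunits \<Longrightarrow> x + y \<in> nonunits"
proof -
  assume xy: "x \<in> nonunits" "y \<in> nonunits"
  have *: "x + y \<in> nonunits" if xy: "x \<in> nonunits" "x \<noteq> 0" "y / x \<in> V" for x y
  proof -
    have "x + y = x * (1 + y / x)" using xy by (simp add: field_simps)
    then show ?thesis using xy one_mem by (simp add: mult_nonunit add_mem)
  qed
  show ?thesis
  proof (cases "x = 0 \<or> y = 0")
    case True then show ?thesis using xy by auto
  next
    case False
    then show ?thesis
      using *[of x y] *[of y x] xy mem_or_inverse_mem[of "y / x"] by (auto simp: add.commute)
  qed
qed

lemma uminus_nonunit: "x \<in> nonunits \<Longrightarrow> - x \<in> nonunits"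
  using mult_nonunit[of x "- 1"] uminus_mem one_mem by simp

lemma diff_nonunit: "x \<in> nonunits \<Longrightarrow> y \<in> nonunits \<Longrightarrow> x - y \<in> nonunits"
  using add_nonunit[of x "- y"] uminus_nonunit[of y] by simp

lemma sum_nonunit: "(\<And>i. i \<in> I \<Longrightarrow> f i \<in> nonunits) \<Longrightarrow> sum f I \<in> nonunits"
  by (induction I rule: infinite_finite_induct) (auto simp: zero_nonunit add_nonunit)

end

section \<open>Saturation of the valuation ring of bounded elements\<close>

text \<open>
  The bounded elements.  They form a valuation ring since a sequence is almost everywhere of norm
  at most \<open>1\<close> or almost everywhere of norm larger than \<open>1\<close>; the non-units are the infinitesimals.
\<close>

definition finite_hyper :: "hyper set" where
  "finite_hyper = {abs_hyper f |f. \<exists>c. eventually (\<lambda>n. norm (f n) \<le> c) nat_ultrafilter}"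

lemma finite_hyper_abs_iff:
  "abs_hyper f \<in> finite_hyper \<longleftrightarrow> (\<exists>c. eventually (\<lambda>n. norm (f n) \<le> c) nat_ultrafilter)"
proof
  assume "abs_hyper f \<in> finite_hyper"
  then obtain g c where "eventually (\<lambda>n. f n = g n) nat_ultrafilter"
    "eventually (\<lambda>n. norm (g n) \<le> c) nat_ultrafilter"
    unfolding finite_hyper_def by (auto simp: hyper.abs_eq_iff)
  then have "eventually (\<lambda>n. norm (f n) \<le> c) nat_ultrafilter"
    by eventually_elim auto
  then show "\<exists>c. eventually (\<lambda>n. norm (f n) \<le> c) nat_ultrafilter" ..
qed (auto simp: finite_hyper_def)

interpretation finite_hyper: valuation_subring finite_hyper
proof
  show "1 \<in> finite_hyper"
    unfolding one_hyper.abs_eq finite_hyper_abs_iff by (intro exI[of _ 1]) simp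
next
  fix x y :: hyper
  obtain f g where x: "x = abs_hyper f" and y: "y = abs_hyper g"
    by (meson hyper_rep)
  { assume "x \<in> finite_hyper" "y \<in> finite_hyper"
    then obtain c d where c: "eventually (\<lambda>n. norm (f n) \<le> c) nat_ultrafilter"
      and d: "eventually (\<lambda>n. norm (g n) \<le> d) nat_ultrafilter"
      unfolding x y finite_hyper_abs_iff by blast
    have "eventually (\<lambda>n. norm (f n + g n) \<le> c + d) nat_ultrafilter"
      using c d by eventually_elim (meson add_mono norm_triangle_le)
    then show "x + y \<in> finite_hyper"
      unfolding x y plus_hyper.abs_eq finite_hyper_abs_iff by blast
    have "eventually (\<lambda>n. norm (f n * g n) \<le> c * d) nat_ultrafilter"
      using c d by eventually_elim (simp add: norm_mult mult_mono' )
    then show "x * y \<in> finite_hyper"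
      unfolding x y times_hyper.abs_eq finite_hyper_abs_iff by blast }
  show "x \<in> finite_hyper \<Longrightarrow> - x \<in> finite_hyper"
    unfolding x uminus_hyper.abs_eq finite_hyper_abs_iff by simp
  show "x \<in> finite_hyper \<or> inverse x \<in> finite_hyper"
  proof (cases "eventually (\<lambda>n. norm (f n) \<le> 1) nat_ultrafilter")
    case True
    then show ?thesis unfolding x finite_hyper_abs_iff by blast
  next
    case False
    then have "eventually (\<lambda>n. \<not> norm (f n) \<le> 1) nat_ultrafilter"
      by (simp only: not_eventually_nat_ultrafilter)
    then have "eventually (\<lambda>n. norm (inverse (f n)) \<le> 1) nat_ultrafilter"
      by eventually_elim (simp add: norm_inverse inverse_le_1_iff)
    then show ?thesis unfolding x inverse_hyper.abs_eq finite_hyper_abs_iff by blast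
  qed
qed

text \<open>
  The reciprocal of a sequence whose \<open>n\<close>-th term exceeds \<open>n\<close> times the norm of the \<open>n\<close>-th term of each
  of the first \<open>n\<close> given sequences.
\<close>

lemma finite_hyper_scale:
  assumes "countable S"
  shows "\<exists>t. t \<noteq> 0 \<and> (\<forall>a\<in>S. t * a \<in> finite_hyper.nonunits)"
proof -
  define a where "a = from_nat_into (insert 0 S)"
  have a: "range a = insert 0 S"
    unfolding a_def using assms by (intro range_from_nat_into) auto
  define f where "f i = rep_hyper (a i)" for i :: nat
  have f: "a i = abs_hyper (f i)" for i
    unfolding f_def by (simp add: abs_rep_hyper)
  define b where "b n = 1 + (\<Sum>i\<le>n. norm (f i n))" for n
  define g where "g n = complex_of_real (inverse (real (Suc n) * b n))" for n
  have b: "b n > 0" and fb: "i \<le> n \<Longrightarrow> norm (f i n) \<le> b n" for i n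
  proof -
    show "b n > 0" unfolding b_def by (intro add_pos_nonneg sum_nonneg) auto
    assume "i \<le> n"
    then have "norm (f i n) \<le> (\<Sum>i\<le>n. norm (f i n))" by (intro member_le_sum) auto
    then show "norm (f i n) \<le> b n" by (simp add: b_def)
  qed
  have g: "g n \<noteq> 0" for n using b[of n] by (simp add: g_def del: of_nat_Suc)
  have "abs_hyper g * a i \<in> finite_hyper.nonunits" for i
  proof (rule ccontr)
    assume "\<not> ?thesis"
    then have nz: "abs_hyper g * a i \<noteq> 0" and "inverse (abs_hyper g * a i) \<in> finite_hyper"
      by (auto simp: finite_hyper.nonunits_def)
    then obtain c where "eventually (\<lambda>n. norm (inverse (g n * f i n)) \<le> c) nat_ultrafilter"
      unfolding f times_hyper.abs_eq inverse_hyper.abs_eq finite_hyper_abs_iff by blast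
    moreover have "eventually (\<lambda>n. g n * f i n \<noteq> 0) nat_ultrafilter"
      using nz unfolding f times_hyper.abs_eq zero_hyper.abs_eq hyper.abs_eq_iff
        not_eventually_nat_ultrafilter .
    moreover have "eventually (\<lambda>n. i \<le> n) nat_ultrafilter"
      "eventually (\<lambda>n. nat \<lceil>c\<rceil> \<le> n) nat_ultrafilter"
      by (rule eventually_nat_ultrafilter_ge)+
    ultimately have "eventually (\<lambda>n. False) nat_ultrafilter"
    proof eventually_elim
      case (elim n)
      have "norm (g n) = inverse (real (Suc n) * b n)"
        using b[of n] unfolding g_def norm_of_real by simp
      then have "norm (g n * f i n) = norm (f i n) / (real (Suc n) * b n)"
        by (simp add: norm_mult divide_inverse mult.commute)
      also have "\<dots> \<le> 1 / real (Suc n)"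
        using b[of n] fb[OF elim(3)] by (simp add: divide_simps del: of_nat_Suc)
      finally have "norm (g n * f i n) \<le> 1 / real (Suc n)" .
      moreover have "norm (g n * f i n) > 0"
        using elim(2) unfolding zero_less_norm_iff .
      ultimately have "inverse (1 / real (Suc n)) \<le> inverse (norm (g n * f i n))"
        by (rule le_imp_inverse_le)
      then have "real (Suc n) \<le> norm (inverse (g n * f i n))"
        by (simp only: norm_inverse inverse_divide div_by_1)
      with elim(1,4) show False by linarith
    qed
    then show False using nat_ultrafilter_not_bot by (simp add: trivial_limit_def)
  qed
  moreover have "abs_hyper g \<noteq> 0"
    using g by (simp add: zero_hyper.abs_eq hyper.abs_eq_iff not_eventually_nat_ultrafilter)
  moreover have "\<exists>i. x = a i" if "x \<in> S" for x
    using a that by blast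
  ultimately show ?thesis by (intro exI[of _ "abs_hyper g"]) auto
qed

text \<open>
  The diagonal argument behind saturation: at index \<open>n\<close>, choose a witness for as many of the first
  \<open>n\<close> conditions as can be met simultaneously.  Each single condition is then met at almost all
  indices.
\<close>

lemma countable_saturation:
  fixes P :: "nat \<Rightarrow> nat \<Rightarrow> 'a \<Rightarrow> bool"
  assumes "U \<le> sequentially"
    and sat: "\<And>j. eventually (\<lambda>n. \<exists>z. \<forall>i\<le>j. P i n z) U"
  shows "\<exists>y. \<forall>i. eventually (\<lambda>n. P i n (y n)) U"
proof -
  \<comment> \<open>the last index up to which all conditions can be met at \<open>n\<close>; bounding it by \<open>n\<close> makes the maximum exist\<close>
  define J where "J n = Max {j. j \<le> n \<and> (\<exists>z. \<forall>i\<le>j. P i n z)}" for n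
  define y where "y n = (SOME z. \<forall>i\<le>J n. P i n z)" for n
  have y: "P i n (y n)" if "i \<le> n" "\<exists>z. \<forall>i'\<le>i. P i' n z" for i n
  proof -
    let ?A = "{j. j \<le> n \<and> (\<exists>z. \<forall>i\<le>j. P i n z)}"
    have fin: "finite ?A" and i: "i \<in> ?A" using that by auto
    have "i \<le> J n" unfolding J_def using fin i by (rule Max_ge)
    have "J n \<in> ?A" unfolding J_def using fin i by (intro Max_in) auto
    then have "\<exists>z. \<forall>i\<le>J n. P i n z" by simp
    from someI_ex[OF this] show ?thesis unfolding y_def[symmetric] using \<open>i \<le> J n\<close> by blast
  qed
  have "eventually (\<lambda>n. P i n (y n)) U" for i
  proof -
    have "eventually (\<lambda>n. i \<le> n) U"
      by (rule filter_leD[OF assms(1) eventually_ge_at_top])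
    with sat[of i] show ?thesis by eventually_elim (use y in blast)
  qed
  then show ?thesis by blast
qed

text \<open>
  Pseudo-Cauchy sequences have pseudo-limits.  The conditions on \<open>y\<close> are stated with the constant
  \<open>1\<close> instead of an unspecified bound, which makes them finitely satisfiable and hence, by saturation,
  jointly satisfiable.
\<close>

lemma finite_hyper_pseudo_limit:
  fixes r s :: "nat \<Rightarrow> hyper"
  assumes r: "\<And>i. r i \<noteq> 0"
    and cauchy: "\<And>i j. i < j \<Longrightarrow> (s j - s i) / r i \<in> finite_hyper.nonunits"
  shows "\<exists>y. \<forall>i. (y - s i) / r i \<in> finite_hyper"
proof -
  define \<sigma> where "\<sigma> i = rep_hyper (s i)" for i :: nat
  define \<rho> where "\<rho> i = rep_hyper (r i)" for i :: nat
  have s: "s i = abs_hyper (\<sigma> i)" and r': "r i = abs_hyper (\<rho> i)" for i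
    unfolding \<sigma>_def \<rho>_def by (simp_all add: abs_rep_hyper)
  have *: "eventually (\<lambda>n. norm ((\<sigma> j n - \<sigma> i n) / \<rho> i n) \<le> 1) nat_ultrafilter" if "i \<le> j" for i j
  proof (cases "(s j - s i) / r i = 0")
    case True
    then show ?thesis
      unfolding s r' minus_hyper.abs_eq divide_hyper.abs_eq zero_hyper.abs_eq hyper.abs_eq_iff
      by (auto elim!: eventually_mono)
  next
    case False
    then have "i < j" using that by (cases "i = j") auto
    then have "inverse ((s j - s i) / r i) \<notin> finite_hyper"
      using cauchy False by (auto simp: finite_hyper.nonunits_def)
    then have "eventually (\<lambda>n. \<not> norm (inverse ((\<sigma> j n - \<sigma> i n) / \<rho> i n)) \<le> 1) nat_ultrafilter"
      unfolding s r' minus_hyper.abs_eq divide_hyper.abs_eq inverse_hyper.abs_eq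
        finite_hyper_abs_iff not_eventually_nat_ultrafilter[symmetric] by blast
    then show ?thesis
    proof eventually_elim
      case (elim n)
      then have "inverse (norm ((\<sigma> j n - \<sigma> i n) / \<rho> i n)) > 1"
        by (simp only: norm_inverse)
      then show ?case by (simp add: one_less_inverse_iff)
    qed
  qed
  have "\<exists>y. \<forall>i. eventually (\<lambda>n. norm ((y n - \<sigma> i n) / \<rho> i n) \<le> 1) nat_ultrafilter"
  proof (rule countable_saturation[OF nat_ultrafilter_le])
    fix j
    have "eventually (\<lambda>n. \<forall>i\<in>{..j}. norm ((\<sigma> j n - \<sigma> i n) / \<rho> i n) \<le> 1) nat_ultrafilter"
      using * by (simp add: eventually_ball_finite_distrib)
    then show "eventually (\<lambda>n. \<exists>z. \<forall>i\<le>j. norm ((z - \<sigma> i n) / \<rho> i n) \<le> 1) nat_ultrafilter"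
      by eventually_elim auto
  qed
  then obtain y where "\<And>i. eventually (\<lambda>n. norm ((y n - \<sigma> i n) / \<rho> i n) \<le> 1) nat_ultrafilter"
    by blast
  then have "(abs_hyper y - s i) / r i \<in> finite_hyper" for i
    unfolding s r' minus_hyper.abs_eq divide_hyper.abs_eq finite_hyper_abs_iff by blast
  then show ?thesis by blast
qed

section \<open>Countable algebraically closed subfields\<close>

definition polys_over :: "'k::zero set \<Rightarrow> 'k poly set" where
  "polys_over L = {p. \<forall>i. poly.coeff p i \<in> L}"

text \<open>
  The condition \<open>root_mem\<close> asks for all roots in the ambient field.  As this field is algebraically closed, a
  polynomial over \<open>L\<close> then splits into linear factors over \<open>L\<close>.
\<close>

locale alg_closed_subfield =
  fixes L :: "'k::alg_closed_field set"
  assumes one_mem: "1 \<in> L"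
    and add_mem: "x \<in> L \<Longrightarrow> y \<in> L \<Longrightarrow> x + y \<in> L"
    and uminus_mem: "x \<in> L \<Longrightarrow> - x \<in> L"
    and mult_mem: "x \<in> L \<Longrightarrow> y \<in> L \<Longrightarrow> x * y \<in> L"
    and inverse_mem: "x \<in> L \<Longrightarrow> inverse x \<in> L"
    and root_mem: "p \<in> polys_over L \<Longrightarrow> p \<noteq> 0 \<Longrightarrow> poly p x = 0 \<Longrightarrow> x \<in> L"
begin

lemma diff_mem: "x \<in> L \<Longrightarrow> y \<in> L \<Longrightarrow> x - y \<in> L"
  using add_mem[of x "- y"] uminus_mem[of y] by simp

lemma zero_mem: "0 \<in> L"
  using diff_mem[OF one_mem one_mem] by simp

lemma sum_mem: "(\<And>i. i \<in> I \<Longrightarrow> f i \<in> L) \<Longrightarrow> sum f I \<in> L"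
  by (induction I rule: infinite_finite_induct) (auto simp: zero_mem add_mem)

lemma polys_over_add: "p \<in> polys_over L \<Longrightarrow> q \<in> polys_over L \<Longrightarrow> p + q \<in> polys_over L"
  by (simp add: polys_over_def add_mem)

lemma polys_over_uminus: "p \<in> polys_over L \<Longrightarrow> - p \<in> polys_over L"
  by (simp add: polys_over_def uminus_mem)

lemma polys_over_mult: "p \<in> polys_over L \<Longrightarrow> q \<in> polys_over L \<Longrightarrow> p * q \<in> polys_over L"
  by (simp add: polys_over_def Polynomial.coeff_mult sum_mem mult_mem)

lemma polys_over_const: "c \<in> L \<Longrightarrow> [:c:] \<in> polys_over L"
  by (simp add: polys_over_def coeff_pCons zero_mem split: nat.split)

lemma polys_over_one: "1 \<in> polys_over L"
  unfolding one_pCons by (rule polys_over_const[OF one_mem])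

lemma polys_over_X: "[:0, 1:] \<in> polys_over L"
  by (simp add: polys_over_def coeff_pCons zero_mem one_mem split: nat.split)

end

lemma finite_subset_UN_incseq:
  assumes "incseq (E :: nat \<Rightarrow> 'a set)" "finite F" "F \<subseteq> (\<Union>n. E n)"
  shows "\<exists>n. F \<subseteq> E n"
  using assms(2,3)
proof (induction F rule: finite_induct)
  case (insert x F)
  then obtain m n where "x \<in> E m" "F \<subseteq> E n" by auto
  then have "insert x F \<subseteq> E (max m n)"
    using incseqD[OF assms(1), of m "max m n"] incseqD[OF assms(1), of n "max m n"] by auto
  then show ?case ..
qed auto

text \<open>
  Each membership condition involves only finitely many elements, which occur together at some
  stage; so it is enough that every operation leads from a stage into the union.
\<close>

lemma alg_closed_subfield_UN:
  fixes E :: "nat \<Rightarrow> 'k::alg_closed_field set"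
  assumes E: "incseq E" and one: "1 \<in> E 0"
    and add: "\<And>n x y. x \<in> E n \<Longrightarrow> y \<in> E n \<Longrightarrow> x + y \<in> (\<Union>n. E n)"
    and uminus: "\<And>n x. x \<in> E n \<Longrightarrow> - x \<in> (\<Union>n. E n)"
    and mult: "\<And>n x y. x \<in> E n \<Longrightarrow> y \<in> E n \<Longrightarrow> x * y \<in> (\<Union>n. E n)"
    and inverse: "\<And>n x. x \<in> E n \<Longrightarrow> inverse x \<in> (\<Union>n. E n)"
    and root: "\<And>n p x. p \<in> polys_over (E n) \<Longrightarrow> p \<noteq> 0 \<Longrightarrow> poly p x = 0 \<Longrightarrow> x \<in> (\<Union>n. E n)"
  shows "alg_closed_subfield (\<Union>n. E n)"
proof
  have zero: "0 \<in> (\<Union>n. E n)"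
  proof -
    obtain n where "- 1 \<in> E n" using uminus[OF one] by blast
    moreover have "1 \<in> E n" using incseqD[OF E, of 0 n] one by auto
    ultimately show ?thesis using add[of "- 1" n 1] by simp
  qed
  show "1 \<in> (\<Union>n. E n)" using one by blast
  fix x y assume x: "x \<in> (\<Union>n. E n)"
  then show "- x \<in> (\<Union>n. E n)" "inverse x \<in> (\<Union>n. E n)"
    using uminus inverse by blast+
  assume "y \<in> (\<Union>n. E n)"
  with x have "{x, y} \<subseteq> (\<Union>n. E n)" by blast
  with finite_subset_UN_incseq[OF E, of "{x, y}"] obtain n where n: "x \<in> E n" "y \<in> E n" by auto
  show "x + y \<in> (\<Union>n. E n)" "x * y \<in> (\<Union>n. E n)"
    by (rule add[OF n], rule mult[OF n])
next
  fix p x assume p: "p \<in> polys_over (\<Union>n. E n)" "p \<noteq> 0" "poly p x = 0"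
  have "range (poly.coeff p) \<subseteq> insert 0 (poly.coeff p ` {..Polynomial.degree p})"
    by (auto simp: image_iff not_le dest!: Polynomial.coeff_eq_0)
       (metis Polynomial.coeff_eq_0 atMost_iff not_le)
  then have "finite (range (poly.coeff p))" by (rule finite_subset) simp
  moreover have "range (poly.coeff p) \<subseteq> (\<Union>n. E n)"
    using p(1) by (auto simp: polys_over_def)
  ultimately obtain n where "range (poly.coeff p) \<subseteq> E n"
    using finite_subset_UN_incseq[OF E, of "range (poly.coeff p)"] by auto
  then have "p \<in> polys_over (E n)" by (auto simp: polys_over_def)
  then show "x \<in> (\<Union>n. E n)" using p(2,3) by (rule root)
qed

lemma countable_polys_over: "countable L \<Longrightarrow> countable (polys_over L)"
proof -
  assume "countable L"
  then have "countable (Poly ` lists L)" by simp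
  moreover have "polys_over L \<subseteq> Poly ` lists L"
  proof
    fix p assume "p \<in> polys_over L"
    then have "Polynomial.coeffs p \<in> lists L"
      by (auto simp: polys_over_def Polynomial.coeffs_def)
    then show "p \<in> Poly ` lists L" by (metis Poly_coeffs image_eqI)
  qed
  ultimately show ?thesis by (rule countable_subset[rotated])
qed

text \<open>
  Adjoin results of field operations and roots of polynomials, and repeat this countably often;
  every stage remains countable.
\<close>

lemma countable_alg_closed_subfield:
  fixes S :: "'k::alg_closed_field set"
  assumes S: "countable S"
  shows "\<exists>L. S \<subseteq> L \<and> countable L \<and> alg_closed_subfield L"
proof -
  define step :: "'k set \<Rightarrow> 'k set" where
    "step E = E \<union> (\<Union>x\<in>E. {- x, inverse x}) \<union> (\<Union>x\<in>E. \<Union>y\<in>E. {x + y, x * y}) \<union>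
      (\<Union>p\<in>polys_over E - {0}. {x. poly p x = 0})" for E
  define E where "E n = (step ^^ n) (insert 1 S)" for n
  have E_Suc: "E (Suc n) = step (E n)" for n by (simp add: E_def)
  have step: "step (E n) \<subseteq> (\<Union>n. E n)" for n by (metis E_Suc UN_upper UNIV_I)
  have "countable (E n)" for n
  proof (induction n)
    case 0
    then show ?case using S by (simp add: E_def)
  next
    case (Suc n)
    then show ?case
      unfolding E_Suc step_def
      by (intro countable_Un countable_UN countable_Diff countable_polys_over)
        (auto intro: countable_finite poly_roots_finite)
  qed
  moreover have "incseq E"
    by (rule incseq_SucI) (auto simp: E_Suc step_def)
  then have "alg_closed_subfield (\<Union>n. E n)"
  proof (rule alg_closed_subfield_UN)
    show "1 \<in> E 0" by (simp add: E_def)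
    fix n x
    show "- x \<in> (\<Union>n. E n)" "inverse x \<in> (\<Union>n. E n)" if "x \<in> E n"
      using that by (intro subsetD[OF step[of n]]; simp add: step_def; blast)+
    show "x + z \<in> (\<Union>n. E n)" "x * z \<in> (\<Union>n. E n)" if "x \<in> E n" "z \<in> E n" for z
      using that by (intro subsetD[OF step[of n]]; simp add: step_def; blast)+
    show "x \<in> (\<Union>n. E n)" if "p \<in> polys_over (E n)" "p \<noteq> 0" "poly p x = 0" for p
      using that by (intro subsetD[OF step[of n]]; simp add: step_def; blast)
  qed
  moreover have "S \<subseteq> (\<Union>n. E n)"
    by (rule subset_trans[OF _ UN_upper[of 0]]) (auto simp: E_def)
  ultimately show ?thesis by blast
qed

section \<open>A tower of fields with new archimedean classes\<close>

text \<open>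
  The last axiom says that the value of \<open>t n\<close> exceeds the values of all non-zero elements of the
  field \<open>L n\<close>; so it lies in a new archimedean class.
\<close>

locale valued_tower = valuation_subring V
  for V :: "'k::alg_closed_field set" +
  fixes L :: "nat \<Rightarrow> 'k set" and t :: "nat \<Rightarrow> 'k"
  assumes subfield_L: "alg_closed_subfield (L n)"
    and countable_L: "countable (L n)"
    and L_Suc: "L n \<subseteq> L (Suc n)"
    and t_mem: "t n \<in> L (Suc n)"
    and t_nonzero: "t n \<noteq> 0"
    and t_mult: "a \<in> L n \<Longrightarrow> t n * a \<in> nonunits"

text \<open>
  Alternately choose an element that is infinitesimal relative to the present field, and close up to
  a countable algebraically closed field again.
\<close>

lemma valued_tower_exists:
  fixes V :: "'k::alg_closed_field set"
  assumes "valuation_subring V"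
    and scale: "\<And>S. countable S \<Longrightarrow>
      \<exists>t. t \<noteq> 0 \<and> (\<forall>a\<in>S. t * a \<in> valuation_subring.nonunits V)"
  shows "\<exists>L t. valued_tower V L t"
proof -
  interpret valuation_subring V by fact
  define C where "C S = (SOME L. S \<subseteq> L \<and> countable L \<and> alg_closed_subfield L)" for S :: "'k set"
  have C: "S \<subseteq> C S" "countable (C S)" "alg_closed_subfield (C S)" if "countable S" for S
    using someI_ex[OF countable_alg_closed_subfield[OF that]] unfolding C_def by blast+
  define T where "T S = (SOME t. t \<noteq> 0 \<and> (\<forall>a\<in>S. t * a \<in> nonunits))" for S
  have T: "T S \<noteq> 0" "a \<in> S \<Longrightarrow> T S * a \<in> nonunits" if "countable S" for S a
    using someI_ex[OF scale[OF that]] unfolding T_def by blast+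
  define L where "L = rec_nat (C {}) (\<lambda>_ E. C (insert (T E) E))"
  have L0: "L 0 = C {}" and LS: "L (Suc n) = C (insert (T (L n)) (L n))" for n
    by (simp_all add: L_def)
  have cL: "countable (L n)" for n
    by (induction n) (simp_all add: L0 LS C)
  have "valued_tower V L (\<lambda>n. T (L n))"
  proof (intro valued_tower.intro valued_tower_axioms.intro)
    fix n
    show "valuation_subring V" by fact
    show "alg_closed_subfield (L n)" by (cases n) (simp_all add: L0 LS C cL)
    show "countable (L n)" by (rule cL)
    have "insert (T (L n)) (L n) \<subseteq> L (Suc n)" unfolding LS by (rule C) (simp add: cL)
    then show "L n \<subseteq> L (Suc n)" "T (L n) \<in> L (Suc n)" by auto
    show "T (L n) \<noteq> 0" by (rule T(1)[OF cL])
    show "T (L n) * a \<in> nonunits" if "a \<in> L n" for a by (rule T(2)[OF cL that])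
  qed
  then show ?thesis by blast
qed

context valued_tower
begin

definition L_union :: "'k set" where
  "L_union = (\<Union>n. L n)"

lemma incseq_L: "incseq L"
  using L_Suc by (rule incseq_SucI)

lemma L_mono: "m \<le> n \<Longrightarrow> x \<in> L m \<Longrightarrow> x \<in> L n"
  using incseqD[OF incseq_L] by blast

lemma L_subset_union: "x \<in> L n \<Longrightarrow> x \<in> L_union"
  by (auto simp: L_union_def)

lemma subfield_L_union: "alg_closed_subfield L_union"
  unfolding L_union_def
proof (rule alg_closed_subfield_UN[OF incseq_L])
  show "1 \<in> L 0" by (rule alg_closed_subfield.one_mem[OF subfield_L])
  fix n
  interpret Ln: alg_closed_subfield "L n" by (rule subfield_L)
  fix x
  show "- x \<in> (\<Union>n. L n)" "inverse x \<in> (\<Union>n. L n)" if "x \<in> L n"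
    using Ln.uminus_mem[OF that] Ln.inverse_mem[OF that] by blast+
  show "x + z \<in> (\<Union>n. L n)" "x * z \<in> (\<Union>n. L n)" if "x \<in> L n" "z \<in> L n" for z
    using Ln.add_mem[OF that] Ln.mult_mem[OF that] by blast+
  show "x \<in> (\<Union>n. L n)" if "p \<in> polys_over (L n)" "p \<noteq> 0" "poly p x = 0" for p
    using Ln.root_mem[OF that] by blast
qed

sublocale L: alg_closed_subfield L_union
  by (rule subfield_L_union)

lemma countable_L_union: "countable L_union"
  unfolding L_union_def by (intro countable_UN countable_L countableI_type)

lemma t_union: "t n \<in> L_union"
  using t_mem by (rule L_subset_union)

lemma t_mem_L: "i < n \<Longrightarrow> t i \<in> L n"
  using t_mem[of i] L_mono[of "Suc i" n] by simp

lemma t_div: "a \<in> L n \<Longrightarrow> t n / a \<in> nonunits"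
  using t_mult[of "inverse a" n] alg_closed_subfield.inverse_mem[OF subfield_L]
  by (simp add: divide_inverse)

lemma t_div_t: "i < n \<Longrightarrow> t n / t i \<in> nonunits"
  by (intro t_div t_mem_L)

lemma t_nonunit: "t n \<in> nonunits"
  using t_mult[of 1 n] alg_closed_subfield.one_mem[OF subfield_L] by simp

definition partial_sum :: "nat \<Rightarrow> 'k" where
  "partial_sum n = (\<Sum>i\<le>n. t i)"

lemma pseudo_cauchy:
  assumes "i < j"
  shows "(partial_sum j - partial_sum i) / t i \<in> nonunits"
proof -
  have "{..j} = {..i} \<union> {i<..j}" using assms by auto
  then have "partial_sum j = partial_sum i + (\<Sum>k\<in>{i<..j}. t k)"
    unfolding partial_sum_def by (metis finite_atMost finite_greaterThanAtMost ivl_disj_int_one(3) sum.union_disjoint)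
  then have "(partial_sum j - partial_sum i) / t i = (\<Sum>k\<in>{i<..j}. t k / t i)"
    by (simp add: sum_divide_distrib)
  also have "\<dots> \<in> nonunits"
    by (rule sum_nonunit) (simp add: t_div_t)
  finally show ?thesis .
qed

text \<open>
  Elements that are not infinitely close to \<open>0\<close> on the scale of the \<open>t n\<close>.
\<close>

definition bounded_below :: "'k \<Rightarrow> bool" where
  "bounded_below x \<longleftrightarrow> x \<noteq> 0 \<and> (\<exists>n. t n / x \<in> V)"

text \<open>
  The closure of \<open>L_union\<close> in the topology with the basic neighbourhoods \<open>t n * V\<close> of zero.
\<close>

definition approximable :: "'k set" where
  "approximable = {x. \<forall>n. \<exists>a\<in>L_union. (x - a) / t n \<in> V}"

lemma bounded_below_L: "a \<in> L_union \<Longrightarrow> a \<noteq> 0 \<Longrightarrow> bounded_below a"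
  unfolding L_union_def bounded_below_def by (auto intro: nonunits_subset t_div)

text \<open>
  The product of two of the elements \<open>t m\<close>, \<open>t n\<close> is an element of a field of the tower, and so is
  dominated by a later \<open>t k\<close>.
\<close>

lemma bounded_below_mult:
  assumes "bounded_below x" "bounded_below y"
  shows "bounded_below (x * y)"
proof -
  obtain m n where mn: "t m / x \<in> V" "t n / y \<in> V" and nz: "x \<noteq> 0" "y \<noteq> 0"
    using assms by (auto simp: bounded_below_def)
  define k where "k = Suc (max m n)"
  have "t m * t n \<in> L k"
    by (intro alg_closed_subfield.mult_mem[OF subfield_L] t_mem_L) (auto simp: k_def)
  then have "t k / (t m * t n) \<in> V" by (intro nonunits_subset t_div)
  then have "t k / (t m * t n) * (t m / x * (t n / y)) \<in> V" using mn by (intro mult_mem)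
  also have "t k / (t m * t n) * (t m / x * (t n / y)) = t k / (x * y)"
    using t_nonzero by (simp add: field_simps)
  finally show ?thesis using nz by (auto simp: bounded_below_def)
qed

lemma L_approximable: "a \<in> L_union \<Longrightarrow> a \<in> approximable"
  unfolding approximable_def using zero_mem by (auto intro!: bexI[of _ a])

lemma approximable_add:
  assumes "x \<in> approximable" "y \<in> approximable"
  shows "x + y \<in> approximable"
  unfolding approximable_def
proof safe
  fix n
  obtain a b where a: "a \<in> L_union" "(x - a) / t n \<in> V" and b: "b \<in> L_union" "(y - b) / t n \<in> V"
    using assms unfolding approximable_def by blast
  have "(x + y - (a + b)) / t n = (x - a) / t n + (y - b) / t n"
    by (simp only: add_diff_add add_divide_distrib)
  also have "\<dots> \<in> V" using a b by (intro add_mem)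
  finally show "\<exists>c\<in>L_union. (x + y - c) / t n \<in> V"
    using a b L.add_mem by blast
qed

lemma approximable_bounded:
  assumes "x \<in> approximable"
  shows "\<exists>n. \<forall>m\<ge>n. t m * x \<in> V"
proof -
  obtain a where a: "a \<in> L_union" "(x - a) / t 0 \<in> V"
    using assms unfolding approximable_def by blast
  then obtain n where n: "a \<in> L n" by (auto simp: L_union_def)
  have "t m * x \<in> V" if "m \<ge> n" for m
  proof -
    have "t m * a \<in> V" by (intro nonunits_subset t_mult L_mono[OF that n])
    moreover have "t m * (t 0 * ((x - a) / t 0)) \<in> V"
      using a t_nonunit nonunits_subset by (intro mult_mem) auto
    ultimately have "t m * a + t m * (t 0 * ((x - a) / t 0)) \<in> V" by (rule add_mem)
    then show ?thesis using t_nonzero[of 0] by (simp add: field_simps)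
  qed
  then show ?thesis by blast
qed

lemma approximable_mult:
  assumes "x \<in> approximable" "y \<in> approximable"
  shows "x * y \<in> approximable"
  unfolding approximable_def
proof safe
  fix n
  obtain k where k: "t k * x \<in> V" "t k * y \<in> V"
  proof -
    obtain k l where "\<forall>m\<ge>k. t m * x \<in> V" "\<forall>m\<ge>l. t m * y \<in> V"
      using assms[THEN approximable_bounded] by blast
    then show ?thesis using that[of "max k l"] by simp
  qed
  define N where "N = Suc (max n k)"
  obtain a b where a: "a \<in> L_union" "(x - a) / t N \<in> V" and b: "b \<in> L_union" "(y - b) / t N \<in> V"
    using assms unfolding approximable_def by blast
  have "t n * t k \<in> L N"
    by (intro alg_closed_subfield.mult_mem[OF subfield_L] t_mem_L) (auto simp: N_def)
  then have N: "t N / (t n * t k) \<in> V" by (intro nonunits_subset t_div)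
  have N': "t N / t n \<in> V" using t_div_t[of n N] nonunits_subset by (simp add: N_def)
  have tN: "t N \<in> V" by (intro nonunits_subset t_nonunit)
  have "(x * y - a * b) / t n =
      (t k * x) * ((y - b) / t N) * (t N / (t n * t k)) +
      (t k * y) * ((x - a) / t N) * (t N / (t n * t k)) -
      ((x - a) / t N) * ((y - b) / t N) * (t N * (t N / t n))"
    using t_nonzero[of n] t_nonzero[of k] t_nonzero[of N] by (simp add: field_simps)
  also have "\<dots> \<in> V"
    by (rule diff_mem[OF add_mem[OF mult_mem[OF mult_mem[OF k(1) b(2)] N]
          mult_mem[OF mult_mem[OF k(2) a(2)] N]] mult_mem[OF mult_mem[OF a(2) b(2)] mult_mem[OF tN N']]])
  finally show "\<exists>c\<in>L_union. (x * y - c) / t n \<in> V"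
    using L.mult_mem a b by blast
qed

lemma one_plus_nonunit:
  assumes "x \<in> nonunits"
  shows "1 + x \<noteq> 0" "inverse (1 + x) \<in> V"
proof -
  have "1 + x \<notin> nonunits"
    using diff_nonunit[of "1 + x" x] assms one_not_nonunit by auto
  then show "1 + x \<noteq> 0" "inverse (1 + x) \<in> V" by (auto simp: nonunits_def)
qed

text \<open>
  If \<open>a\<close> is close enough to \<open>x\<close>, then \<open>a = x (1 + e)\<close> with \<open>e\<close> a non-unit, and the difference of
  the inverses is controlled by \<open>(x - a) / x\<^sup>2\<close>.
\<close>

lemma approximable_inverse:
  assumes "x \<in> approximable" "bounded_below x"
  shows "inverse x \<in> approximable"
  unfolding approximable_def
proof safe
  fix n
  obtain k where k: "t k / x \<in> V" and x: "x \<noteq> 0" using assms(2) by (auto simp: bounded_below_def)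
  define N where "N = Suc (max n k)"
  obtain a where a: "a \<in> L_union" "(x - a) / t N \<in> V"
    using assms unfolding approximable_def by blast
  have "t n * (t k * t k) \<in> L N"
    by (intro alg_closed_subfield.mult_mem[OF subfield_L] t_mem_L) (auto simp: N_def)
  then have N: "t N / (t n * (t k * t k)) \<in> V" by (intro nonunits_subset t_div)
  have N': "t N / t k \<in> nonunits" using t_div_t[of k N] by (simp add: N_def)
  define e where "e = - ((t N / t k) * (((x - a) / t N) * (t k / x)))"
  have e: "e \<in> nonunits"
    unfolding e_def using k a N' by (intro uminus_nonunit mult_nonunit mult_mem)
  have "a = x * (1 + e)"
    using x t_nonzero[of k] t_nonzero[of N] by (simp add: e_def field_simps)
  then have "(inverse x - inverse a) / t n =
      - (((x - a) / t N) * ((t k / x) * (t k / x)) * (t N / (t n * (t k * t k))) * inverse (1 + e))"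
    using x t_nonzero[of n] t_nonzero[of k] t_nonzero[of N] one_plus_nonunit(1)[OF e]
    by (simp add: divide_simps) (simp add: algebra_simps)
  also have "\<dots> \<in> V"
    using k a N one_plus_nonunit(2)[OF e] by (intro uminus_mem mult_mem)
  finally show "\<exists>c\<in>L_union. (inverse x - c) / t n \<in> V"
    using L.inverse_mem a by blast
qed

end

section \<open>Adjoining a transcendental limit\<close>

locale valued_tower_limit = valued_tower V L t
  for V :: "'k::alg_closed_field set" and L :: "nat \<Rightarrow> 'k set" and t :: "nat \<Rightarrow> 'k" +
  fixes y :: 'k
  assumes y_limit: "(y - partial_sum n) / t n \<in> V"
begin

lemma partial_sum_union: "partial_sum n \<in> L_union"
  unfolding partial_sum_def by (intro L.sum_mem t_union)

lemma y_approximable: "y \<in> approximable"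
  unfolding approximable_def using y_limit partial_sum_union by blast

text \<open>
  Write \<open>y - a = e + t m (1 + d)\<close> with \<open>e \<in> L m\<close> and \<open>d\<close> a non-unit.  Either \<open>e = 0\<close> and the
  difference has the value of \<open>t m\<close>, or \<open>e\<close> dominates and the difference has the smaller value of \<open>e\<close>.
\<close>

lemma y_diff_bounded_below:
  assumes "a \<in> L_union"
  shows "bounded_below (y - a)"
proof -
  obtain m where m: "a \<in> L m" using assms by (auto simp: L_union_def)
  define e where "e = (\<Sum>i<m. t i) - a"
  have e: "e \<in> L m"
  proof -
    interpret Lm: alg_closed_subfield "L m" by (rule subfield_L)
    show ?thesis unfolding e_def by (intro Lm.diff_mem Lm.sum_mem t_mem_L m) simp
  qed
  \<comment> \<open>\<open>d\<close> collects everything in \<open>y\<close> after the term \<open>t m\<close>, relative to \<open>t m\<close>.\<close>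
  define d where "d = (t (Suc m) / t m) * (1 + (y - partial_sum (Suc m)) / t (Suc m))"
  have d: "d \<in> nonunits"
    unfolding d_def by (intro mult_nonunit t_div_t add_mem one_mem y_limit) simp
  have "partial_sum (Suc m) = e + a + t m + t (Suc m)"
    by (simp add: partial_sum_def e_def lessThan_Suc_atMost[symmetric])
  then have eq: "y - a = e + t m * (1 + d)"
    using t_nonzero[of m] t_nonzero[of "Suc m"] by (simp add: d_def field_simps)
  show ?thesis
  proof (cases "e = 0")
    case True
    then show ?thesis
      using eq one_plus_nonunit[OF d] t_nonzero[of m]
      by (auto simp: bounded_below_def inverse_eq_divide intro!: exI[of _ m])
  next
    case False
    define c where "c = (t m / e) * (1 + d)"
    have c: "c \<in> nonunits"
      unfolding c_def using d nonunits_subset by (intro mult_nonunit t_div e add_mem one_mem)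
    have eq': "y - a = e * (1 + c)"
      using False by (simp add: eq c_def field_simps)
    have "t m / e * inverse (1 + c) \<in> V"
      using one_plus_nonunit(2)[OF c] t_div[OF e] nonunits_subset by (intro mult_mem)
    then show ?thesis
      using eq' False one_plus_nonunit(1)[OF c]
      by (auto simp: bounded_below_def divide_simps intro!: exI[of _ m])
  qed
qed

lemma poly_y_approximable:
  assumes "p \<in> polys_over L_union"
  shows "poly p y \<in> approximable"
  using assms
proof (induction p)
  case 0
  then show ?case using L_approximable[OF L.zero_mem] by simp
next
  case (pCons c p)
  have *: "poly.coeff (pCons c p) i \<in> L_union" for i
    using pCons.prems by (simp add: polys_over_def)
  have "c \<in> L_union" "p \<in> polys_over L_union"
    using *[of 0] *[of "Suc _"] by (simp_all add: polys_over_def)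
  then show ?case
    using pCons.IH by (simp add: approximable_add approximable_mult L_approximable y_approximable)
qed

text \<open>
  Factor the polynomial over \<open>L_union\<close>.  In particular, \<open>y\<close> is transcendental over \<open>L_union\<close>.
\<close>

lemma poly_y_bounded_below:
  assumes p: "p \<in> polys_over L_union" "p \<noteq> 0"
  shows "bounded_below (poly p y)"
proof -
  obtain A where A: "p = smult (Polynomial.lead_coeff p) (\<Prod>x\<in>#A. [:- x, 1:])"
    using alg_closed_imp_factorization[OF p(2)] by metis
  have "x \<in> L_union" if "x \<in># A" for x
  proof (rule L.root_mem[OF p])
    have "[:- x, 1:] dvd (\<Prod>x\<in>#A. [:- x, 1:])"
      using that by (intro dvd_prod_mset) auto
    then have "[:- x, 1:] dvd p" by (subst A) (rule dvd_smult)
    then show "poly p x = 0" by (simp add: poly_eq_0_iff_dvd)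
  qed
  then have "bounded_below (\<Prod>x\<in>#A. y - x)"
  proof (induction A)
    case empty
    then show ?case using bounded_below_L[OF L.one_mem] by simp
  next
    case (add x A)
    then show ?case by (simp add: bounded_below_mult y_diff_bounded_below)
  qed
  moreover have "poly p y = Polynomial.lead_coeff p * (\<Prod>x\<in>#A. y - x)"
    by (subst A) (simp add: poly_prod_mset image_mset.compositionality o_def)
  moreover have "bounded_below (Polynomial.lead_coeff p)"
    using p by (intro bounded_below_L) (auto simp: polys_over_def)
  ultimately show ?thesis by (simp add: bounded_below_mult)
qed

definition K :: "'k set" where
  "K = {poly p y / poly q y |p q. p \<in> polys_over L_union \<and> q \<in> polys_over L_union \<and> q \<noteq> 0}"

lemma poly_y_nonzero: "p \<in> polys_over L_union \<Longrightarrow> p \<noteq> 0 \<Longrightarrow> poly p y \<noteq> 0"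
  using poly_y_bounded_below by (auto simp: bounded_below_def)

lemma K_I: "p \<in> polys_over L_union \<Longrightarrow> q \<in> polys_over L_union \<Longrightarrow> q \<noteq> 0 \<Longrightarrow>
    poly p y / poly q y \<in> K"
  by (auto simp: K_def)

lemma K_E:
  assumes "x \<in> K"
  obtains p q where "p \<in> polys_over L_union" "q \<in> polys_over L_union" "q \<noteq> 0"
    "poly q y \<noteq> 0" "x = poly p y / poly q y"
  using assms poly_y_nonzero by (auto simp: K_def)

lemma L_subset_K: "a \<in> L_union \<Longrightarrow> a \<in> K"
  using K_I[OF L.polys_over_const L.polys_over_one, of a] by simp

lemma y_mem_K: "y \<in> K"
  using K_I[OF L.polys_over_X L.polys_over_one] by simp

lemma K_add: "x \<in> K \<Longrightarrow> x' \<in> K \<Longrightarrow> x + x' \<in> K"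
proof (elim K_E)
  fix p q p' q' assume *: "p \<in> polys_over L_union" "q \<in> polys_over L_union" "q \<noteq> 0"
    "p' \<in> polys_over L_union" "q' \<in> polys_over L_union" "q' \<noteq> 0"
    "poly q y \<noteq> 0" "poly q' y \<noteq> 0" and x: "x = poly p y / poly q y" "x' = poly p' y / poly q' y"
  have "poly (p * q' + p' * q) y / poly (q * q') y \<in> K"
    using * by (intro K_I L.polys_over_add L.polys_over_mult) auto
  also have "poly (p * q' + p' * q) y / poly (q * q') y = x + x'"
    unfolding x using *(7,8) by (simp add: field_simps)
  finally show ?thesis .
qed

lemma K_mult: "x \<in> K \<Longrightarrow> x' \<in> K \<Longrightarrow> x * x' \<in> K"
proof (elim K_E)
  fix p q p' q' assume *: "p \<in> polys_over L_union" "q \<in> polys_over L_union" "q \<noteq> 0"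
    "p' \<in> polys_over L_union" "q' \<in> polys_over L_union" "q' \<noteq> 0"
    and x: "x = poly p y / poly q y" "x' = poly p' y / poly q' y"
  have "poly (p * p') y / poly (q * q') y \<in> K"
    using * by (intro K_I L.polys_over_mult) auto
  then show ?thesis using x by simp
qed

lemma K_uminus: "x \<in> K \<Longrightarrow> - x \<in> K"
  using K_mult[OF L_subset_K[OF L.uminus_mem[OF L.one_mem]]] by simp

lemma K_inverse: "x \<in> K \<Longrightarrow> inverse x \<in> K"
proof (elim K_E)
  fix p q assume *: "p \<in> polys_over L_union" "q \<in> polys_over L_union" "q \<noteq> 0"
    and x: "x = poly p y / poly q y"
  show ?thesis
  proof (cases "p = 0")
    case True
    then show ?thesis using x L_subset_K[OF L.zero_mem] by simp
  next
    case False
    then show ?thesis using K_I[OF *(2,1)] x by simp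
  qed
qed

lemma countable_K: "countable K"
proof -
  have "K \<subseteq> (\<lambda>(p, q). poly p y / poly q y) ` (polys_over L_union \<times> polys_over L_union)"
    by (auto simp: K_def)
  moreover have "countable (polys_over L_union \<times> polys_over L_union)"
    by (intro countable_SIGMA countable_polys_over countable_L_union)
  ultimately show ?thesis using countable_subset by blast
qed

lemma K_approximable: "x \<in> K \<Longrightarrow> x \<in> approximable"
proof (erule K_E)
  fix p q assume "p \<in> polys_over L_union" "q \<in> polys_over L_union" "q \<noteq> 0"
    and x: "x = poly p y / poly q y"
  then show ?thesis
    unfolding x divide_inverse
    by (intro approximable_mult approximable_inverse poly_y_approximable poly_y_bounded_below)
qed

lemma K_bounded_below:
  assumes "x \<in> K"
  shows "\<exists>n. t n / x \<in> V"
proof -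
  have "inverse x \<in> approximable" by (intro K_approximable K_inverse assms)
  then obtain n where "\<forall>m\<ge>n. t m * inverse x \<in> V" using approximable_bounded by blast
  then show ?thesis by (auto simp: divide_inverse)
qed

text \<open>
  A root \<open>p(y) / q(y)\<close> would give the polynomial identity \<open>p (p + q) = X q\<^sup>2\<close>.  Its right-hand side
  has odd degree, whereas the left-hand side has degree \<open>2 deg p\<close> if \<open>deg p > deg q\<close>, and degree at
  most \<open>2 deg q\<close> otherwise.
\<close>

lemma no_artin_schreier_root:
  assumes "b \<in> K"
  shows "b * b + b \<noteq> y"
proof
  assume b: "b * b + b = y"
  obtain p q where pq: "p \<in> polys_over L_union" "q \<in> polys_over L_union" "q \<noteq> 0" "poly q y \<noteq> 0"
    "b = poly p y / poly q y" using K_E[OF assms] .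
  define f where "f = p * p + p * q + - ([:0, 1:] * (q * q))"
  have "poly f y = 0"
    using b pq(4) unfolding f_def pq(5) by (simp add: field_simps)
  moreover have "f \<in> polys_over L_union"
    unfolding f_def using pq
    by (intro L.polys_over_add L.polys_over_mult L.polys_over_uminus L.polys_over_X)
  ultimately have "f = 0" using poly_y_nonzero by blast
  then have eq: "p * (p + q) = [:0, 1:] * (q * q)"
    unfolding f_def eq_neg_iff_add_eq_0[symmetric] minus_minus distrib_left .
  have deg: "Polynomial.degree ([:0, 1:] * (q * q)) = Suc (2 * Polynomial.degree q)"
    using pq(3) by (simp add: degree_mult_eq)
  have nz: "p \<noteq> 0" "p + q \<noteq> 0" using eq pq(3) by auto
  have deg': "Polynomial.degree p + Polynomial.degree (p + q) = Suc (2 * Polynomial.degree q)"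
    using deg degree_mult_eq[OF nz] by (simp add: eq)
  show False
  proof (cases "Polynomial.degree p > Polynomial.degree q")
    case True
    then have "Polynomial.degree (p + q) = Polynomial.degree p"
      by (rule degree_add_eq_left)
    then show False using deg' by presburger
  next
    case False
    then have "Polynomial.degree (p + q) \<le> Polynomial.degree q"
      by (simp add: degree_add_le)
    then show False using deg' False by simp
  qed
qed

end

section \<open>Roots near approximate roots\<close>

context valuation_subring
begin

text \<open>
  \<open>p'/p\<close> is the sum of the terms \<open>1 / (a - x)\<close> over the roots \<open>x\<close>.
\<close>

lemma logarithmic_derivative_mem:
  fixes a :: 'k
  assumes "\<forall>x\<in>#A. a - x \<notin> nonunits"
  defines "p \<equiv> (\<Prod>x\<in>#A. [:- x, 1:])"
  shows "poly p a \<noteq> 0 \<and> poly (pderiv p) a / poly p a \<in> V"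
  using assms(1) unfolding p_def
proof (induction A)
  case empty
  then show ?case using zero_mem by simp
next
  case (add x A)
  let ?q = "\<Prod>x\<in>#A. [:- x, 1:]"
  have x: "a - x \<notin> nonunits" and q: "poly ?q a \<noteq> 0" "poly (pderiv ?q) a / poly ?q a \<in> V"
    using add by auto
  then have nz: "a - x \<noteq> 0" using zero_nonunit by auto
  have val: "poly ([:- x, 1:] * ?q) a = (a - x) * poly ?q a"
    unfolding poly_mult by (simp add: algebra_simps)
  have "poly (pderiv ([:- x, 1:] * ?q)) a = poly ?q a + (a - x) * poly (pderiv ?q) a"
    unfolding pderiv_mult poly_add poly_mult by (simp add: pderiv_pCons algebra_simps)
  then have "poly (pderiv ([:- x, 1:] * ?q)) a / poly ([:- x, 1:] * ?q) a =
      inverse (a - x) + poly (pderiv ?q) a / poly ?q a"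
    unfolding val using nz q(1) by (simp add: divide_simps)
  moreover have "inverse (a - x) \<in> V" using x by (auto simp: nonunits_def)
  ultimately have "poly (pderiv ([:- x, 1:] * ?q)) a / poly ([:- x, 1:] * ?q) a \<in> V"
    using add_mem q(2) by metis
  then show ?case using val q(1) nz by (simp del: mult_pCons_left)
qed

end

text \<open>
  If no root were near \<open>a\<close>, then \<open>p'(a) = p(a) * (p'(a) / p(a))\<close> would be a non-unit.
\<close>

lemma hensel_root_near:
  fixes V :: "'k::alg_closed_field set"
  assumes "valuation_subring V"
    and p: "poly p a \<in> valuation_subring.nonunits V"
    and p': "poly (pderiv p) a \<notin> valuation_subring.nonunits V"
  shows "\<exists>b. poly p b = 0 \<and> a - b \<in> valuation_subring.nonunits V"
proof (rule ccontr)
  assume contra: "\<not> ?thesis"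
  interpret valuation_subring V by fact
  have "p \<noteq> 0" using p' zero_nonunit by auto
  then obtain A where A: "p = smult (Polynomial.lead_coeff p) (\<Prod>x\<in>#A. [:- x, 1:])"
    using alg_closed_imp_factorization by metis
  let ?q = "\<Prod>x\<in>#A. [:- x, 1:]"
  have "a - x \<notin> nonunits" if "x \<in># A" for x
  proof -
    have "[:- x, 1:] dvd ?q" using that by (intro dvd_prod_mset) auto
    then have "[:- x, 1:] dvd p" by (subst A) (rule dvd_smult)
    then show ?thesis using contra by (simp add: poly_eq_0_iff_dvd)
  qed
  then have q: "poly ?q a \<noteq> 0" "poly (pderiv ?q) a / poly ?q a \<in> V"
    using logarithmic_derivative_mem[of A a] by auto
  have "poly (pderiv p) a = poly p a * (poly (pderiv ?q) a / poly ?q a)"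
    by (subst (1 2) A) (use q(1) in \<open>simp add: pderiv_smult\<close>)
  then show False using p p' mult_nonunit[OF p q(2)] by simp
qed

section \<open>Polynomials over types and over rings with carrier\<close>

text \<open>
  Coefficient lists start with the leading coefficient, as in the polynomial rings over rings with
  carrier.
\<close>

fun list_poly :: "'k::idom list \<Rightarrow> 'k poly" where
  "list_poly [] = 0"
| "list_poly (c # cs) = Polynomial.monom c (length cs) + list_poly cs"

text \<open>
  A homomorphism from a subring of a type into a ring with explicit carrier.  It serves to transfer
  the evaluation of polynomials, and of their derivatives, to the polynomials over types.
\<close>

locale partial_ring_hom = ring R
  for R :: "('r, 'b) ring_scheme" (structure) +
  fixes C :: "'k::idom set" and \<rho> :: "'k \<Rightarrow> 'r"
  assumes C_zero: "0 \<in> C" and C_one: "1 \<in> C"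
    and C_add: "a \<in> C \<Longrightarrow> b \<in> C \<Longrightarrow> a + b \<in> C"
    and C_mult: "a \<in> C \<Longrightarrow> b \<in> C \<Longrightarrow> a * b \<in> C"
    and map_carrier: "a \<in> C \<Longrightarrow> \<rho> a \<in> carrier R"
    and map_one: "\<rho> 1 = \<one>"
    and map_add: "a \<in> C \<Longrightarrow> b \<in> C \<Longrightarrow> \<rho> (a + b) = \<rho> a \<oplus> \<rho> b"
    and map_mult: "a \<in> C \<Longrightarrow> b \<in> C \<Longrightarrow> \<rho> (a * b) = \<rho> a \<otimes> \<rho> b"
begin

lemma map_zero: "\<rho> 0 = \<zero>"
  using map_add[OF C_zero C_zero] map_carrier[OF C_zero]
  by (metis add.l_cancel_one' add_0 zero_closed)

lemma map_diff:
  assumes "a \<in> C" "b \<in> C" "a - b \<in> C"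
  shows "\<rho> (a - b) = \<rho> a \<ominus> \<rho> b"
proof -
  have "\<rho> (a - b) \<oplus> \<rho> b = \<rho> a"
    using map_add[OF assms(3,2)] by simp
  then have "\<rho> a \<ominus> \<rho> b = (\<rho> (a - b) \<oplus> \<rho> b) \<ominus> \<rho> b" by simp
  also have "\<dots> = \<rho> (a - b)"
    using assms map_carrier by (simp add: a_minus_def a_assoc r_neg)
  finally show ?thesis ..
qed

lemma map_power: "a \<in> C \<Longrightarrow> a ^ n \<in> C \<and> \<rho> (a ^ n) = \<rho> a [^] n"
proof (induction n)
  case (Suc n)
  then have "\<rho> (a ^ n * a) = \<rho> (a ^ n) \<otimes> \<rho> a" by (intro map_mult) auto
  with Suc show ?case by (simp add: C_mult mult.commute)
qed (simp add: C_one map_one)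

lemma map_nat_mult: "a \<in> C \<Longrightarrow> of_nat n * a \<in> C \<and> \<rho> (of_nat n * a) = [n] \<cdot> \<rho> a"
proof (induction n)
  case (Suc n)
  then have "\<rho> (of_nat n * a + a) = \<rho> (of_nat n * a) \<oplus> \<rho> a" by (intro map_add) auto
  with Suc show ?case by (simp add: C_add distrib_right add.commute)
qed (simp add: C_zero map_zero)

lemma map_poly_eval:
  assumes "set cs \<subseteq> C" "a \<in> C"
  shows "poly (list_poly cs) a \<in> C \<and> eval (map \<rho> cs) (\<rho> a) = \<rho> (poly (list_poly cs) a)"
  using assms(1)
proof (induction cs)
  case Nil
  then show ?case by (simp add: C_zero map_zero)
next
  case (Cons c cs)
  have c: "c \<in> C" and IH: "poly (list_poly cs) a \<in> C"
    "eval (map \<rho> cs) (\<rho> a) = \<rho> (poly (list_poly cs) a)"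
    using Cons by auto
  have pow: "a ^ length cs \<in> C" "\<rho> (a ^ length cs) = \<rho> a [^] length cs"
    using map_power[OF assms(2)] by auto
  then show ?case
    using c IH map_mult[OF c pow(1)] map_add[OF C_mult[OF c pow(1)] IH(1)]
    by (simp add: poly_monom C_mult C_add)
qed

lemma map_formal_deriv:
  assumes "set cs \<subseteq> C"
  shows "\<exists>ds. set ds \<subseteq> C \<and> length ds = length cs - 1 \<and>
    formal_deriv R (map \<rho> cs) = map \<rho> ds \<and> list_poly ds = pderiv (list_poly cs)"
  using assms
proof (induction cs)
  case Nil
  then show ?case by (intro exI[of _ "[]"]) auto
next
  case (Cons c cs)
  show ?case
  proof (cases cs)
    case Nil
    then show ?thesis by (intro exI[of _ "[]"]) (auto simp: monom_0 pderiv_pCons)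
  next
    case (Cons d es)
    obtain ds where ds: "set ds \<subseteq> C" "length ds = length es"
      "formal_deriv R (map \<rho> cs) = map \<rho> ds" "list_poly ds = pderiv (list_poly cs)"
      using Cons.IH Cons.prems Cons by auto
    have "of_nat (length cs) * c \<in> C" "\<rho> (of_nat (length cs) * c) = [length cs] \<cdot> \<rho> c"
      using map_nat_mult Cons.prems by auto
    then show ?thesis
      using ds Cons by (intro exI[of _ "of_nat (length cs) * c # ds"])
        (simp add: pderiv_add pderiv_monom)
  qed
qed

end

lemma (in alg_closed_subfield) list_poly_over: "set cs \<subseteq> L \<Longrightarrow> list_poly cs \<in> polys_over L"
  by (induction cs) (auto simp: polys_over_def zero_mem add_mem)

text \<open>
  If the valuation ring is the image of the valuation ring of an algebraically closed subfield, with
  corresponding maximal ideals, then polynomials lift to the latter and split there.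
\<close>

lemma henselian_via_lift:
  fixes V L :: "'k::alg_closed_field set" and R :: "('r, 'b) ring_scheme"
    and u :: "('r, 'g, 'c) valuation_scheme"
  assumes u: "valued_field R u" and V: "valuation_subring V" and L: "alg_closed_subfield L"
    and \<rho>: "partial_ring_hom R (L \<inter> V) \<rho>"
    and surj: "\<rho> ` (L \<inter> V) = valuation_ring R u"
    and ideal: "\<And>a. a \<in> L \<inter> V \<Longrightarrow>
      \<rho> a \<in> valuation_ideal R u \<longleftrightarrow> a \<in> valuation_subring.nonunits V"
  shows "henselian R u"
  unfolding henselian_def
proof (intro conjI ballI impI)
  interpret V: valuation_subring V by fact
  interpret L: alg_closed_subfield L by fact
  interpret \<rho>: partial_ring_hom R "L \<inter> V" \<rho> by fact
  fix f \<alpha>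
  assume f: "f \<in> carrier (univ_poly R (valuation_ring R u))" and \<alpha>: "\<alpha> \<in> valuation_ring R u"
    and root: "\<rho>.eval f \<alpha> \<in> valuation_ideal R u \<and>
      \<rho>.eval (formal_deriv R f) \<alpha> \<notin> valuation_ideal R u"
  have "set f \<subseteq> \<rho> ` (L \<inter> V)"
    using f unfolding surj univ_poly_def polynomial_def by auto
  then have "f \<in> map \<rho> ` lists (L \<inter> V)"
    unfolding lists_image[symmetric] by auto
  then obtain cs where cs: "set cs \<subseteq> L \<inter> V" "f = map \<rho> cs" by auto
  obtain a where a: "a \<in> L \<inter> V" "\<alpha> = \<rho> a" using \<alpha> surj by blast
  obtain ds where ds: "set ds \<subseteq> L \<inter> V" "formal_deriv R f = map \<rho> ds"
    "list_poly ds = pderiv (list_poly cs)"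
    using \<rho>.map_formal_deriv[OF cs(1)] cs(2) by blast
  have p: "poly (list_poly cs) a \<in> V.nonunits" "poly (pderiv (list_poly cs)) a \<notin> V.nonunits"
    using root \<rho>.map_poly_eval[OF cs(1) a(1)] \<rho>.map_poly_eval[OF ds(1) a(1)] ideal
    unfolding cs(2)[symmetric] ds(2)[symmetric] ds(3)[symmetric] a(2) by simp_all
  obtain b where b: "poly (list_poly cs) b = 0" "a - b \<in> V.nonunits"
    using hensel_root_near[OF V p] by blast
  have "list_poly cs \<noteq> 0" using p(2) V.zero_nonunit by auto
  then have "b \<in> L"
    using L.root_mem[OF L.list_poly_over _ b(1)] cs(1) by auto
  moreover have "b = a - (a - b)" by simp
  then have "b \<in> V" using a(1) V.diff_mem[OF _ V.nonunits_subset[OF b(2)]] by (metis IntD2)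
  ultimately have bC: "b \<in> L \<inter> V" by blast
  have ba: "b - a \<in> L \<inter> V" "b - a \<in> V.nonunits"
    using bC a(1) L.diff_mem V.diff_mem V.uminus_nonunit[OF b(2)] by auto
  show "\<exists>\<beta>\<in>valuation_ring R u. \<rho>.eval f \<beta> = \<zero>\<^bsub>R\<^esub> \<and> \<beta> \<ominus>\<^bsub>R\<^esub> \<alpha> \<in> valuation_ideal R u"
  proof (intro bexI conjI)
    show "\<rho> b \<in> valuation_ring R u" using bC surj by blast
    show "\<rho>.eval f (\<rho> b) = \<zero>\<^bsub>R\<^esub>"
      using \<rho>.map_poly_eval[OF cs(1) bC] b(1) \<rho>.map_zero by (simp add: cs(2))
    show "\<rho> b \<ominus>\<^bsub>R\<^esub> \<alpha> \<in> valuation_ideal R u"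
      using \<rho>.map_diff[OF bC a(1) ba(1)] ideal[OF ba(1)] ba(2) by (simp add: a(2))
  qed
qed (rule u)

section \<open>The valuation of a valuation ring\<close>

locale valuation_ring_of_field = field K
  for K :: "('a, 'b) ring_scheme" (structure) +
  fixes A :: "'a set"
  assumes subring_A: "subring A K"
    and mem_or_inv_mem: "x \<in> carrier K \<Longrightarrow> x \<noteq> \<zero> \<Longrightarrow> x \<in> A \<or> inv x \<in> A"
begin

definition max_ideal :: "'a set" where
  "max_ideal = A - ring_units K A"

lemmas A_sub = subringE(1)[OF subring_A]
lemmas A_zero = subringE(2)[OF subring_A]
lemmas A_one = subringE(3)[OF subring_A]
lemmas A_minus = subringE(5)[OF subring_A]
lemmas A_mult = subringE(6)[OF subring_A]
lemmas A_add = subringE(7)[OF subring_A]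

lemma A_carrier: "x \<in> A \<Longrightarrow> x \<in> carrier K"
  using A_sub by blast

lemma inv_nonzero:
  assumes "x \<in> carrier K" "x \<noteq> \<zero>"
  shows "inv x \<in> carrier K" "inv x \<noteq> \<zero>" "x \<otimes> inv x = \<one>" "inv x \<otimes> x = \<one>" "inv (inv x) = x"
proof -
  have U: "x \<in> Units K" using assms field_Units by blast
  show "inv x \<in> carrier K" "x \<otimes> inv x = \<one>" "inv x \<otimes> x = \<one>" "inv (inv x) = x"
    using U by simp_all
  show "inv x \<noteq> \<zero>" using Units_inv_Units[OF U] field_Units by blast
qed

lemma unit_in_A: "x \<in> ring_units K A \<longleftrightarrow> x \<in> A \<and> x \<noteq> \<zero> \<and> inv x \<in> A"
  by (auto simp: ring_units_def)

lemma inv_mult_nonzero: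
  assumes "x \<in> carrier K" "x \<noteq> \<zero>" "y \<in> carrier K" "y \<noteq> \<zero>"
  shows "x \<otimes> y \<noteq> \<zero>" "inv (x \<otimes> y) = inv x \<otimes> inv y"
proof -
  show "x \<otimes> y \<noteq> \<zero>" using assms integral by blast
  show "inv (x \<otimes> y) = inv x \<otimes> inv y"
  proof (rule comm_inv_char)
    note ix = inv_nonzero[OF assms(1,2)] and iy = inv_nonzero[OF assms(3,4)]
    have "x \<otimes> y \<otimes> (inv x \<otimes> inv y) = (x \<otimes> inv x) \<otimes> (y \<otimes> inv y)"
      using assms ix(1) iy(1) by (simp add: m_ac)
    then show "x \<otimes> y \<otimes> (inv x \<otimes> inv y) = \<one>" using ix(3) iy(3) by simp
  qed (use assms inv_nonzero in auto)
qed

lemma units_of_carrier: "carrier (units_of K) = carrier K - {\<zero>}"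
  by (simp add: units_of_def field_Units)

lemma subgroup_units: "subgroup (ring_units K A) (units_of K)"
proof (rule group.subgroupI)
  show "group (units_of K)" by (rule units_group)
  show "ring_units K A \<subseteq> carrier (units_of K)"
    using A_carrier by (auto simp: units_of_carrier unit_in_A)
  have "\<one> \<in> ring_units K A" using A_one by (simp add: unit_in_A)
  then show "ring_units K A \<noteq> {}" by blast
next
  fix x assume x: "x \<in> ring_units K A"
  then have "x \<in> Units K" using A_carrier field_Units by (auto simp: unit_in_A)
  then have "inv\<^bsub>units_of K\<^esub> x = inv x" by (rule units_of_inv)
  then show "inv\<^bsub>units_of K\<^esub> x \<in> ring_units K A"
    using x inv_nonzero A_carrier by (auto simp: unit_in_A)
next
  fix x y assume xy: "x \<in> ring_units K A" "y \<in> ring_units K A"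
  then show "x \<otimes>\<^bsub>units_of K\<^esub> y \<in> ring_units K A"
    using A_carrier inv_mult_nonzero[of x y] A_mult by (auto simp: unit_in_A units_of_mult)
qed

abbreviation vA :: "('a, 'a set) valuation" where
  "vA \<equiv> valuation_of_ring K A"

lemma comm_group_Mod: "comm_group (units_of K Mod ring_units K A)"
  using comm_group.abelian_FactGroup[OF units_comm_group subgroup_units] .

lemma vA_simps:
  "carrier vA = carrier (units_of K Mod ring_units K A)"
  "monoid.mult vA = monoid.mult (units_of K Mod ring_units K A)"
  "one vA = one (units_of K Mod ring_units K A)"
  by (simp_all add: valuation_of_ring_def)

lemma comm_group_vA: "comm_group vA"
proof -
  interpret M: comm_group "units_of K Mod ring_units K A" by (rule comm_group_Mod)
  show ?thesis
  proof (rule comm_groupI, unfold vA_simps)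
    fix S assume "S \<in> carrier (units_of K Mod ring_units K A)"
    then show "\<exists>T\<in>carrier (units_of K Mod ring_units K A).
        T \<otimes>\<^bsub>units_of K Mod ring_units K A\<^esub> S = \<one>\<^bsub>units_of K Mod ring_units K A\<^esub>"
      using M.inv_closed M.l_inv by blast
  qed (fact M.m_closed M.one_closed M.m_assoc M.m_comm M.l_one)+
qed

lemma val_carrier: "x \<in> carrier K \<Longrightarrow> x \<noteq> \<zero> \<Longrightarrow> val vA x \<in> carrier vA"
  by (auto simp: valuation_of_ring_def FactGroup_def RCOSETS_def units_of_carrier)

lemma val_carrierE:
  assumes "g \<in> carrier vA"
  obtains x where "x \<in> carrier K" "x \<noteq> \<zero>" "g = val vA x"
  using assms by (auto simp: valuation_of_ring_def FactGroup_def RCOSETS_def units_of_carrier)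

lemma val_hom: "val vA \<in> hom (units_of K) vA"
proof -
  interpret G: comm_group "units_of K" by (rule units_comm_group)
  interpret N: normal "ring_units K A" "units_of K"
    using G.normal_iff_subgroup subgroup_units by blast
  show ?thesis
    using N.r_coset_hom_Mod by (simp add: valuation_of_ring_def hom_def)
qed

lemma val_mult:
  assumes "x \<in> carrier K" "x \<noteq> \<zero>" "y \<in> carrier K" "y \<noteq> \<zero>"
  shows "val vA (x \<otimes> y) = val vA x \<otimes>\<^bsub>vA\<^esub> val vA y"
  using hom_mult[OF val_hom, of x y] assms by (simp add: units_of_carrier units_of_mult)

lemma val_eq_iff:
  assumes "x \<in> carrier K" "x \<noteq> \<zero>" "y \<in> carrier K" "y \<noteq> \<zero>"
  shows "val vA x = val vA y \<longleftrightarrow> y \<otimes> inv x \<in> ring_units K A"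
proof -
  interpret G: comm_group "units_of K" by (rule units_comm_group)
  have inv: "inv\<^bsub>units_of K\<^esub> x = inv x" using assms field_Units by (intro units_of_inv) blast
  have "val vA x = val vA y \<longleftrightarrow> y \<in> ring_units K A #>\<^bsub>units_of K\<^esub> x"
    unfolding valuation_of_ring_def
    using G.rcos_self[OF _ subgroup_units, of y] G.repr_independence[OF _ _ subgroup_units, of y x] assms
    by (auto simp: units_of_carrier)
  also have "\<dots> \<longleftrightarrow> y \<otimes>\<^bsub>units_of K\<^esub> inv\<^bsub>units_of K\<^esub> x \<in> ring_units K A"
    using subgroup.rcos_module[OF subgroup_units G.is_group, of x y] assms
    by (simp add: units_of_carrier)
  finally show ?thesis by (simp add: inv units_of_mult)
qed

text \<open>
  The order is defined by existence of representatives of the two cosets; changing representatives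
  multiplies the quotient by a unit of \<open>A\<close>.
\<close>

lemma val_le_iff:
  assumes x: "x \<in> carrier K" "x \<noteq> \<zero>" and y: "y \<in> carrier K" "y \<noteq> \<zero>"
  shows "val vA x \<preceq>\<^bsub>vA\<^esub> val vA y \<longleftrightarrow> y \<otimes> inv x \<in> A"
proof
  interpret G: comm_group "units_of K" by (rule units_comm_group)
  have self: "x \<in> val vA x" if "x \<in> carrier K" "x \<noteq> \<zero>" for x
    using G.rcos_self[OF _ subgroup_units, of x] that by (simp add: valuation_of_ring_def units_of_carrier)
  show "val vA x \<preceq>\<^bsub>vA\<^esub> val vA y" if "y \<otimes> inv x \<in> A"
    using self[OF x] self[OF y] that by (auto simp: valuation_of_ring_def)
  assume "val vA x \<preceq>\<^bsub>vA\<^esub> val vA y"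
  then obtain u w where "u \<in> ring_units K A" "w \<in> ring_units K A"
    and mem: "(w \<otimes> y) \<otimes> inv (u \<otimes> x) \<in> A"
    by (auto simp: valuation_of_ring_def r_coset_def units_of_mult)
  then have u: "u \<in> A" "u \<noteq> \<zero>" "inv u \<in> A" and w: "w \<in> A" "w \<noteq> \<zero>" "inv w \<in> A"
    by (auto simp: unit_in_A)
  then have uc: "u \<in> carrier K" "w \<in> carrier K" using A_carrier by auto
  note iu = inv_nonzero[OF uc(1) u(2)] and iw = inv_nonzero[OF uc(2) w(2)] and ix = inv_nonzero[OF x]
  have "y \<otimes> inv x = (u \<otimes> inv u) \<otimes> (w \<otimes> inv w) \<otimes> (y \<otimes> inv x)"
    using iu iw ix y by simp
  also have "\<dots> = u \<otimes> inv w \<otimes> ((w \<otimes> y) \<otimes> inv (u \<otimes> x))"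
    using inv_mult_nonzero[OF uc(1) u(2) x] iu(1) iw(1) ix(1) uc y(1) x(1)
    by (simp add: m_ac)
  also have "\<dots> \<in> A" by (intro A_mult u w mem)
  finally show "y \<otimes> inv x \<in> A" .
qed

lemma one_vA: "one vA = val vA \<one>"
proof -
  interpret G: comm_group "units_of K" by (rule units_comm_group)
  have "ring_units K A #>\<^bsub>units_of K\<^esub> \<one>\<^bsub>units_of K\<^esub> = ring_units K A"
    by (rule G.coset_mult_one) (use A_carrier in \<open>auto simp: units_of_carrier unit_in_A\<close>)
  then show ?thesis by (simp add: valuation_of_ring_def FactGroup_def units_of_one)
qed

lemma quotient_trans:
  assumes "x \<in> carrier K" "y \<in> carrier K" "y \<noteq> \<zero>" "z \<in> carrier K" "z \<noteq> \<zero>"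
  shows "x \<otimes> inv z = (x \<otimes> inv y) \<otimes> (y \<otimes> inv z)"
proof -
  note iy = inv_nonzero[OF assms(2,3)] and iz = inv_nonzero[OF assms(4,5)]
  have "(x \<otimes> inv y) \<otimes> (y \<otimes> inv z) = x \<otimes> (inv y \<otimes> y) \<otimes> inv z"
    using assms iy(1) iz(1) by (simp add: m_assoc)
  then show ?thesis using assms iy iz by simp
qed

lemma inv_quotient:
  assumes "x \<in> carrier K" "x \<noteq> \<zero>" "y \<in> carrier K" "y \<noteq> \<zero>"
  shows "inv (x \<otimes> inv y) = y \<otimes> inv x" "x \<otimes> inv y \<noteq> \<zero>" "x \<otimes> inv y \<in> carrier K"
  using assms inv_nonzero[OF assms(1,2)] inv_nonzero[OF assms(3,4)]
    inv_mult_nonzero[OF assms(1,2), of "inv y"] by (simp_all add: m_comm)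

lemma valued_field_vA: "valued_field K vA"
proof (intro valued_field.intro ordered_abelian_group.intro valued_field_axioms.intro
    ordered_abelian_group_axioms.intro)
  show "field K" by (rule field_axioms)
  show "comm_group vA" by (rule comm_group_vA)
  show "val vA \<in> hom (units_of K) vA" by (rule val_hom)
next
  fix x y assume xy: "x \<in> carrier K - {\<zero>}" "y \<in> carrier K - {\<zero>}" "x \<oplus> y \<noteq> \<zero>"
  have *: "val vA x \<preceq>\<^bsub>vA\<^esub> val vA (x \<oplus> y)"
    if "x \<in> carrier K" "x \<noteq> \<zero>" "y \<in> carrier K" "y \<noteq> \<zero>" "x \<oplus> y \<noteq> \<zero>" "y \<otimes> inv x \<in> A" for x y
  proof -
    have "(x \<oplus> y) \<otimes> inv x = \<one> \<oplus> y \<otimes> inv x"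
      using that inv_nonzero[OF that(1,2)] by (simp add: l_distr)
    also have "\<dots> \<in> A" using that(6) A_one A_add by blast
    finally show ?thesis using that by (simp add: val_le_iff)
  qed
  have "y \<otimes> inv x \<in> A \<or> x \<otimes> inv y \<in> A"
    using mem_or_inv_mem[of "y \<otimes> inv x"] inv_quotient[of y x] xy by auto
  then show "val vA x \<preceq>\<^bsub>vA\<^esub> val vA (x \<oplus> y) \<or> val vA y \<preceq>\<^bsub>vA\<^esub> val vA (x \<oplus> y)"
    using *[of x y] *[of y x] xy a_comm[of x y] by auto
next
  fix g h assume gh: "g \<in> carrier vA" "h \<in> carrier vA"
  obtain x where x: "x \<in> carrier K" "x \<noteq> \<zero>" "g = val vA x" using gh(1) by (rule val_carrierE)
  obtain y where y: "y \<in> carrier K" "y \<noteq> \<zero>" "h = val vA y" using gh(2) by (rule val_carrierE)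
  show "g \<preceq>\<^bsub>vA\<^esub> h \<or> h \<preceq>\<^bsub>vA\<^esub> g"
    using mem_or_inv_mem[of "y \<otimes> inv x"] inv_quotient[of y x] x y by (auto simp: val_le_iff)
  show "g = h" if "g \<preceq>\<^bsub>vA\<^esub> h" "h \<preceq>\<^bsub>vA\<^esub> g"
    using that inv_quotient[of y x] x y by (auto simp: val_le_iff val_eq_iff unit_in_A)
  fix k assume "k \<in> carrier vA"
  then obtain z where z: "z \<in> carrier K" "z \<noteq> \<zero>" "k = val vA z" by (rule val_carrierE)
  show "g \<preceq>\<^bsub>vA\<^esub> k" if "g \<preceq>\<^bsub>vA\<^esub> h" "h \<preceq>\<^bsub>vA\<^esub> k"
    using that quotient_trans[of z y x] x y z A_mult by (auto simp: val_le_iff)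
  show "g \<otimes>\<^bsub>vA\<^esub> k \<preceq>\<^bsub>vA\<^esub> h \<otimes>\<^bsub>vA\<^esub> k" if "g \<preceq>\<^bsub>vA\<^esub> h"
  proof -
    note ix = inv_nonzero[OF x(1,2)] and iz = inv_nonzero[OF z(1,2)]
    have "(y \<otimes> z) \<otimes> inv (x \<otimes> z) = (y \<otimes> inv x) \<otimes> (z \<otimes> inv z)"
      using inv_mult_nonzero[OF x(1,2) z(1,2)] ix(1) iz(1) x(1) y(1) z(1) by (simp add: m_ac)
    also have "\<dots> = y \<otimes> inv x" using ix iz y(1) by simp
    finally show ?thesis
      using that x y z inv_mult_nonzero[OF x(1,2) z(1,2)] inv_mult_nonzero[OF y(1,2) z(1,2)]
      by (simp add: val_le_iff flip: val_mult)
  qed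
qed

lemma one_le_val_iff:
  "x \<in> carrier K \<Longrightarrow> x \<noteq> \<zero> \<Longrightarrow> one vA \<preceq>\<^bsub>vA\<^esub> val vA x \<longleftrightarrow> x \<in> A"
  by (simp add: one_vA val_le_iff)

lemma val_eq_one_iff:
  "x \<in> carrier K \<Longrightarrow> x \<noteq> \<zero> \<Longrightarrow> val vA x = one vA \<longleftrightarrow> x \<in> ring_units K A"
  using val_eq_iff[of \<one> x] by (auto simp: one_vA)

lemma valuation_ring_vA: "valuation_ring K vA = A"
proof (rule Set.set_eqI)
  show "x \<in> valuation_ring K vA \<longleftrightarrow> x \<in> A" for x
    using A_carrier[of x] A_zero one_le_val_iff[of x]
    by (cases "x = \<zero>") (auto simp: valuation_ring_def)
qed

lemma valuation_ideal_vA: "valuation_ideal K vA = max_ideal"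
proof (rule Set.set_eqI)
  show "x \<in> valuation_ideal K vA \<longleftrightarrow> x \<in> max_ideal" for x
    using A_carrier[of x] A_zero one_le_val_iff[of x] val_eq_one_iff[of x]
    by (cases "x = \<zero>") (auto simp: valuation_ideal_def max_ideal_def unit_in_A)
qed

end

section \<open>Residue fields and induced valuations\<close>

context valuation_ring_of_field
begin

abbreviation RA :: "('a, 'b) ring_scheme" where
  "RA \<equiv> K\<lparr>carrier := A\<rparr>"

lemma cring_RA: "cring RA"
  using subcring_iff[OF A_sub] subcringI'[OF subring_A] by blast

lemma max_ideal_iff: "x \<in> max_ideal \<longleftrightarrow> x \<in> A \<and> (x = \<zero> \<or> inv x \<notin> A)"
  by (auto simp: max_ideal_def unit_in_A)

lemma max_ideal_mult:
  assumes x: "x \<in> max_ideal" and y: "y \<in> A"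
  shows "y \<otimes> x \<in> max_ideal"
proof (cases "x = \<zero> \<or> y = \<zero>")
  case True
  then show ?thesis using assms A_carrier A_zero by (auto simp: max_ideal_iff)
next
  case False
  then have xy: "x \<in> carrier K" "x \<noteq> \<zero>" "y \<in> carrier K" "y \<noteq> \<zero>"
    using assms A_carrier by (auto simp: max_ideal_iff)
  note ix = inv_nonzero[OF xy(1,2)] and iy = inv_nonzero[OF xy(3,4)]
  have "y \<otimes> inv (y \<otimes> x) = (y \<otimes> inv y) \<otimes> inv x"
    using inv_mult_nonzero(2)[OF xy(3,4,1,2)] ix(1) iy(1) xy by (simp add: m_assoc)
  then have "y \<otimes> inv (y \<otimes> x) = inv x" using ix iy by simp
  then have "inv (y \<otimes> x) \<notin> A"
    using A_mult[OF y, of "inv (y \<otimes> x)"] x False max_ideal_iff by metis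
  then show ?thesis using A_mult[OF y] x by (auto simp: max_ideal_iff)
qed

lemma max_ideal_add:
  assumes "x \<in> max_ideal" "y \<in> max_ideal"
  shows "x \<oplus> y \<in> max_ideal"
proof -
  have *: "x \<oplus> y \<in> max_ideal"
    if x: "x \<in> max_ideal" "x \<noteq> \<zero>" and y: "y \<in> max_ideal" and yx: "y \<otimes> inv x \<in> A" for x y
  proof -
    have c: "x \<in> carrier K" "y \<in> carrier K" using x y A_carrier by (auto simp: max_ideal_iff)
    note ix = inv_nonzero[OF c(1) x(2)]
    have "(\<one> \<oplus> y \<otimes> inv x) \<otimes> x = x \<oplus> y \<otimes> (inv x \<otimes> x)"
      using c ix(1) by (simp add: l_distr m_assoc)
    then have "(\<one> \<oplus> y \<otimes> inv x) \<otimes> x = x \<oplus> y" using ix c by simp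
    moreover have "(\<one> \<oplus> y \<otimes> inv x) \<otimes> x \<in> max_ideal"
      by (intro max_ideal_mult x A_add A_one yx)
    ultimately show ?thesis by simp
  qed
  have c: "x \<in> carrier K" "y \<in> carrier K" using assms A_carrier by (auto simp: max_ideal_iff)
  show ?thesis
  proof (cases "x = \<zero> \<or> y = \<zero>")
    case True
    then show ?thesis using assms c by auto
  next
    case False
    then have "y \<otimes> inv x \<in> A \<or> x \<otimes> inv y \<in> A"
      using mem_or_inv_mem[of "y \<otimes> inv x"] inv_quotient[of y x] c by auto
    then show ?thesis
      using *[of x y] *[of y x] assms False a_comm[OF c] by auto
  qed
qed

lemma ideal_max_ideal: "ideal max_ideal RA"
proof -
  interpret RA: cring RA by (rule cring_RA)
  show ?thesis
  proof (rule idealI)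
    show "ring RA" by (rule RA.ring_axioms)
    show "subgroup max_ideal (add_monoid RA)"
    proof (rule group.subgroupI)
      show "group (add_monoid RA)" by (rule RA.add.is_group)
      show "max_ideal \<subseteq> carrier (add_monoid RA)" by (auto simp: max_ideal_iff)
      have "\<zero> \<in> max_ideal" using A_zero by (simp add: max_ideal_iff)
      then show "max_ideal \<noteq> {}" by blast
      fix x assume x: "x \<in> max_ideal"
      then have xA: "x \<in> carrier RA" by (simp add: max_ideal_iff)
      have "\<ominus>\<^bsub>RA\<^esub> x = (\<ominus>\<^bsub>RA\<^esub> \<one>\<^bsub>RA\<^esub>) \<otimes>\<^bsub>RA\<^esub> x"
        using RA.l_minus[OF RA.one_closed xA] RA.l_one[OF xA] by simp
      also have "\<dots> \<in> max_ideal"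
        using max_ideal_mult[OF x] RA.a_inv_closed[OF RA.one_closed] by simp
      finally show "inv\<^bsub>add_monoid RA\<^esub> x \<in> max_ideal" by (simp add: a_inv_def)
      show "x \<otimes>\<^bsub>add_monoid RA\<^esub> y \<in> max_ideal" if "y \<in> max_ideal" for y
        using max_ideal_add[OF x that] by simp
    qed
  next
    fix a x assume a: "a \<in> max_ideal" and x: "x \<in> carrier RA"
    show "x \<otimes>\<^bsub>RA\<^esub> a \<in> max_ideal" using max_ideal_mult a x by simp
    then show "a \<otimes>\<^bsub>RA\<^esub> x \<in> max_ideal"
      using RA.m_comm[of a x] a x by (simp add: max_ideal_iff)
  qed
qed

lemma maximalideal_max_ideal: "maximalideal max_ideal RA"
proof (rule maximalidealI[OF ideal_max_ideal])
  have "\<one> \<notin> max_ideal" using A_one by (simp add: max_ideal_iff)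
  then show "carrier RA \<noteq> max_ideal" using A_one by auto
  fix J assume J: "ideal J RA" "max_ideal \<subseteq> J" "J \<subseteq> carrier RA"
  show "J = max_ideal \<or> J = carrier RA"
  proof (cases "J = max_ideal")
    case False
    then obtain x where x: "x \<in> J" "x \<notin> max_ideal" using J by blast
    then have u: "x \<in> A" "x \<noteq> \<zero>" "inv x \<in> A" using J(3) by (auto simp: max_ideal_iff)
    then have "inv x \<otimes>\<^bsub>RA\<^esub> x \<in> J"
      using ideal.I_l_closed[OF J(1) x(1)] by simp
    then have "\<one>\<^bsub>RA\<^esub> \<in> J" using inv_nonzero(4)[OF A_carrier[OF u(1)] u(2)] by simp
    then have "J = carrier RA" by (rule ideal.one_imp_carrier[OF J(1)])
    then show ?thesis ..
  qed simp
qed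

abbreviation residue_class_field :: "'a set ring" where
  "residue_class_field \<equiv> RA Quot max_ideal"

abbreviation residue :: "'a \<Rightarrow> 'a set" where
  "residue x \<equiv> max_ideal +>\<^bsub>RA\<^esub> x"

lemma field_residue: "field residue_class_field"
  using maximalideal.quotient_is_field[OF maximalideal_max_ideal cring_RA] .

lemma residue_hom: "residue \<in> ring_hom RA residue_class_field"
  using ideal.rcos_ring_hom[OF ideal_max_ideal] .

lemma residue_simps:
  "x \<in> A \<Longrightarrow> residue x \<in> carrier residue_class_field"
  "x \<in> A \<Longrightarrow> y \<in> A \<Longrightarrow> residue (x \<otimes> y) = residue x \<otimes>\<^bsub>residue_class_field\<^esub> residue y"
  "x \<in> A \<Longrightarrow> y \<in> A \<Longrightarrow> residue (x \<oplus> y) = residue x \<oplus>\<^bsub>residue_class_field\<^esub> residue y"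
  "residue \<one> = \<one>\<^bsub>residue_class_field\<^esub>"
  using ring_hom_closed[OF residue_hom, of x] ring_hom_mult[OF residue_hom, of x y]
    ring_hom_add[OF residue_hom, of x y] ring_hom_one[OF residue_hom] by simp_all

lemma residue_surj: "carrier residue_class_field = residue ` A"
  by (auto simp: FactRing_def A_RCOSETS_def' )

lemma residue_eq_zero_iff:
  assumes "x \<in> A"
  shows "residue x = \<zero>\<^bsub>residue_class_field\<^esub> \<longleftrightarrow> x \<in> max_ideal"
proof -
  interpret I: ideal max_ideal RA by (rule ideal_max_ideal)
  have "\<zero>\<^bsub>residue_class_field\<^esub> = max_ideal" by (simp add: FactRing_def)
  then show ?thesis
    using I.a_rcos_self[of x] I.a_rcos_const[of x] assms by auto
qed

lemma residue_eq_iff: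
  assumes "x \<in> A" "y \<in> A"
  shows "residue x = residue y \<longleftrightarrow> x \<ominus> y \<in> max_ideal"
proof -
  interpret Q: field residue_class_field by (rule field_residue)
  have xy: "x \<ominus> y \<in> A" using assms A_minus A_add by (simp add: a_minus_def)
  have "x = (x \<ominus> y) \<oplus> y" using assms A_carrier by (simp add: a_minus_def a_assoc l_neg)
  then have "residue x = residue (x \<ominus> y) \<oplus>\<^bsub>residue_class_field\<^esub> residue y"
    using residue_simps(3)[OF xy assms(2)] by simp
  then have "residue x = residue y \<longleftrightarrow> residue (x \<ominus> y) = \<zero>\<^bsub>residue_class_field\<^esub>"
    using residue_simps(1) assms xy by (metis Q.add.r_cancel_one')
  then show ?thesis using residue_eq_zero_iff[OF xy] by simp
qed

lemma residue_inv:
  assumes "x \<in> A" "x \<notin> max_ideal"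
  shows "inv\<^bsub>residue_class_field\<^esub> (residue x) = residue (inv x)"
proof -
  interpret Q: field residue_class_field by (rule field_residue)
  have u: "x \<noteq> \<zero>" "inv x \<in> A" using assms by (auto simp: max_ideal_iff)
  then have "residue x \<otimes>\<^bsub>residue_class_field\<^esub> residue (inv x) = \<one>\<^bsub>residue_class_field\<^esub>"
    using residue_simps(2)[OF assms(1) u(2)] residue_simps(4)
      inv_nonzero(3)[OF A_carrier[OF assms(1)] u(1)] by simp
  then show ?thesis using Q.comm_inv_char residue_simps(1) assms(1) u(2) by blast
qed

text \<open>
  The inverse of a non-zero non-unit of \<open>A\<close> lies outside \<open>A\<close>, and hence outside \<open>B\<close>.
\<close>

lemma max_ideal_subset:
  assumes "valuation_ring_of_field K B" "B \<subseteq> A"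
  shows "max_ideal \<subseteq> valuation_ring_of_field.max_ideal K B"
proof
  interpret B: valuation_ring_of_field K B by fact
  fix x assume x: "x \<in> max_ideal"
  show "x \<in> B.max_ideal"
  proof (cases "x = \<zero>")
    case True
    then show ?thesis using B.A_zero by (simp add: B.max_ideal_iff)
  next
    case False
    then have "inv x \<notin> B" "x \<in> carrier K"
      using x assms(2) A_carrier by (auto simp: max_ideal_iff)
    then show ?thesis using B.mem_or_inv_mem[of x] False by (auto simp: B.max_ideal_iff)
  qed
qed

lemma valuation_ring_of_residue_field:
  assumes "valuation_ring_of_field K B" "B \<subseteq> A"
  shows "valuation_ring_of_field residue_class_field (residue ` B)"
proof -
  interpret B: valuation_ring_of_field K B by fact
  interpret Q: field residue_class_field by (rule field_residue)
  have BA: "x \<in> A" if "x \<in> B" for x using that assms(2) by blast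
  show ?thesis
  proof (intro valuation_ring_of_field.intro valuation_ring_of_field_axioms.intro)
    show "field residue_class_field" by (rule field_residue)
    show "subring (residue ` B) residue_class_field"
    proof (rule Q.subringI)
      show "residue ` B \<subseteq> carrier residue_class_field" using residue_simps(1) BA by blast
      show "\<one>\<^bsub>residue_class_field\<^esub> \<in> residue ` B"
        using residue_simps(4) B.A_one by (metis image_eqI)
      fix S T assume "S \<in> residue ` B"
      then obtain x where x: "x \<in> B" "S = residue x" by blast
      have "residue (\<ominus> x) \<oplus>\<^bsub>residue_class_field\<^esub> residue x = residue \<zero>"
        using residue_simps(3)[of "\<ominus> x" x] BA x(1) B.A_minus l_neg A_carrier by simp
      also have "\<dots> = \<zero>\<^bsub>residue_class_field\<^esub>"
        using residue_eq_zero_iff[OF A_zero] A_zero by (simp add: max_ideal_iff)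
      finally have "\<ominus>\<^bsub>residue_class_field\<^esub> S = residue (\<ominus> x)"
        using Q.minus_equality residue_simps(1) BA x B.A_minus by simp
      then show "\<ominus>\<^bsub>residue_class_field\<^esub> S \<in> residue ` B" using x B.A_minus by blast
      assume "T \<in> residue ` B"
      then obtain y where y: "y \<in> B" "T = residue y" by blast
      show "S \<otimes>\<^bsub>residue_class_field\<^esub> T \<in> residue ` B"
        using residue_simps(2)[OF BA BA, OF x(1) y(1)] B.A_mult[OF x(1) y(1)] x(2) y(2)
        by (metis image_eqI)
      show "S \<oplus>\<^bsub>residue_class_field\<^esub> T \<in> residue ` B"
        using residue_simps(3)[OF BA BA, OF x(1) y(1)] B.A_add[OF x(1) y(1)] x(2) y(2)
        by (metis image_eqI)
    qed
    fix S assume "S \<in> carrier residue_class_field" and nz: "S \<noteq> \<zero>\<^bsub>residue_class_field\<^esub>"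
    then obtain x where x: "x \<in> A" "S = residue x" unfolding residue_surj by blast
    have xm: "x \<notin> max_ideal" using residue_eq_zero_iff[OF x(1)] nz x(2) by simp
    then have "x \<noteq> \<zero>" using x(1) by (auto simp: max_ideal_iff)
    then have "x \<in> B \<or> inv x \<in> B" using B.mem_or_inv_mem A_carrier[OF x(1)] by blast
    then show "S \<in> residue ` B \<or> inv\<^bsub>residue_class_field\<^esub> S \<in> residue ` B"
      using x(2) residue_inv[OF x(1) xm] by blast
  qed
qed

text \<open>
  Units of the image lift to units: if \<open>inv x\<close> agrees with some \<open>b \<in> B\<close> up to an element of the
  maximal ideal of \<open>A\<close>, it lies in \<open>B\<close> itself, as this ideal is contained in \<open>B\<close>.
\<close>

lemma residue_mem_max_ideal_iff:
  assumes "valuation_ring_of_field K B" "B \<subseteq> A" "x \<in> B"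
  shows "residue x \<in> valuation_ring_of_field.max_ideal residue_class_field (residue ` B) \<longleftrightarrow>
    x \<in> valuation_ring_of_field.max_ideal K B"
proof -
  interpret B: valuation_ring_of_field K B by fact
  interpret Q: valuation_ring_of_field residue_class_field "residue ` B"
    by (rule valuation_ring_of_residue_field) fact+
  have x: "x \<in> A" using assms by blast
  show ?thesis
  proof (cases "x \<in> max_ideal")
    case True
    then show ?thesis
      using max_ideal_subset[OF assms(1,2)] residue_eq_zero_iff[OF x] Q.A_zero
      by (auto simp: Q.max_ideal_iff)
  next
    case False
    then have ix: "x \<noteq> \<zero>" "inv x \<in> A" using x by (auto simp: max_ideal_iff)
    have "residue (inv x) \<in> residue ` B \<longleftrightarrow> inv x \<in> B"
    proof
      assume "residue (inv x) \<in> residue ` B"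
      then obtain b where b: "b \<in> B" "residue (inv x) = residue b" by blast
      then have "inv x \<ominus> b \<in> max_ideal" using residue_eq_iff[OF ix(2), of b] assms(2) by blast
      then have "inv x \<ominus> b \<in> B"
        using max_ideal_subset[OF assms(1,2)] by (auto simp: B.max_ideal_iff)
      then have "(inv x \<ominus> b) \<oplus> b \<in> B" using b(1) B.A_add by blast
      then show "inv x \<in> B"
        using A_carrier[OF ix(2)] B.A_carrier[OF b(1)] by (simp add: a_minus_def a_assoc l_neg)
    qed simp
    then show ?thesis
      using residue_inv[OF x False] residue_eq_zero_iff[OF x] False ix(1) assms(3)
      by (simp add: Q.max_ideal_iff B.max_ideal_iff)
  qed
qed

end

section \<open>The valuation ring of a valued field\<close>

context valued_field
begin

lemma val_one: "val v \<one> = one v"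
proof -
  interpret U: comm_group "units_of K" by (rule units_comm_group)
  interpret h: group_hom "units_of K" v "val v"
    by (intro group_hom.intro group_hom_axioms.intro val_hom U.is_group vgroup.is_group)
  show ?thesis using h.hom_one by (simp add: units_of_one)
qed

lemma val_carrier: "x \<in> carrier K \<Longrightarrow> x \<noteq> \<zero> \<Longrightarrow> val v x \<in> carrier v"
  using hom_in_carrier[OF val_hom, of x] by (simp add: units_of_def field_Units)

lemma val_mult:
  "x \<in> carrier K \<Longrightarrow> x \<noteq> \<zero> \<Longrightarrow> y \<in> carrier K \<Longrightarrow> y \<noteq> \<zero> \<Longrightarrow>
    val v (x \<otimes> y) = val v x \<otimes>\<^bsub>v\<^esub> val v y"
  using hom_mult[OF val_hom, of x y] by (simp add: units_of_def field_Units)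

lemma one_le_mult:
  assumes "g \<in> carrier v" "h \<in> carrier v" "one v \<preceq>\<^bsub>v\<^esub> g" "one v \<preceq>\<^bsub>v\<^esub> h"
  shows "one v \<preceq>\<^bsub>v\<^esub> g \<otimes>\<^bsub>v\<^esub> h"
proof -
  have "h \<preceq>\<^bsub>v\<^esub> g \<otimes>\<^bsub>v\<^esub> h"
    using vgroup.preceq_mult[of "one v" g h] assms by simp
  then show ?thesis
    using vgroup.preceq_trans[of "one v" h "g \<otimes>\<^bsub>v\<^esub> h"] assms by simp
qed

lemma inv_val:
  assumes "x \<in> carrier K" "x \<noteq> \<zero>"
  shows "inv x \<in> carrier K" "inv x \<noteq> \<zero>" "val v x \<otimes>\<^bsub>v\<^esub> val v (inv x) = one v"
proof -
  have U: "x \<in> Units K" using assms field_Units by blast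
  show "inv x \<in> carrier K" "inv x \<noteq> \<zero>"
    using Units_inv_Units[OF U] field_Units by auto
  then show "val v x \<otimes>\<^bsub>v\<^esub> val v (inv x) = one v"
    using val_mult[OF assms, of "inv x"] U val_one by simp
qed

lemma inverse_le:
  assumes "g \<in> carrier v" "h \<in> carrier v" "g \<otimes>\<^bsub>v\<^esub> h = one v"
  shows "one v \<preceq>\<^bsub>v\<^esub> g \<longleftrightarrow> h \<preceq>\<^bsub>v\<^esub> one v"
  using vgroup.preceq_mult[of "one v" g h] vgroup.preceq_mult[of h "one v" g] assms
    vgroup.m_comm[of g h] by auto

lemma val_minus:
  assumes "x \<in> carrier K" "x \<noteq> \<zero>" "one v \<preceq>\<^bsub>v\<^esub> val v x"
  shows "one v \<preceq>\<^bsub>v\<^esub> val v (\<ominus> x)"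
proof -
  have m1: "\<ominus> \<one> \<in> carrier K" "\<ominus> \<one> \<noteq> \<zero>"
    by simp (metis minus_minus minus_zero one_closed one_not_zero)
  have "val v (\<ominus> \<one>) \<otimes>\<^bsub>v\<^esub> val v (\<ominus> \<one>) = one v"
    using val_mult[OF m1 m1] val_one by (simp add: l_minus r_minus)
  then have "one v \<preceq>\<^bsub>v\<^esub> val v (\<ominus> \<one>)"
    using inverse_le[of "val v (\<ominus> \<one>)" "val v (\<ominus> \<one>)"] val_carrier[OF m1]
      vgroup.preceq_total[of "one v" "val v (\<ominus> \<one>)"] by auto
  moreover have "val v (\<ominus> x) = val v (\<ominus> \<one>) \<otimes>\<^bsub>v\<^esub> val v x"
    using val_mult[OF m1 assms(1,2)] assms(1) by (simp add: l_minus)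
  ultimately show ?thesis
    using one_le_mult[of "val v (\<ominus> \<one>)" "val v x"] val_carrier m1 assms by simp
qed

lemma valuation_ring_of_field: "valuation_ring_of_field K (valuation_ring K v)"
proof (intro valuation_ring_of_field.intro valuation_ring_of_field_axioms.intro)
  show "field K" by (rule field_axioms)
  show "subring (valuation_ring K v) K"
  proof (rule subringI)
    show "valuation_ring K v \<subseteq> carrier K" by (auto simp: valuation_ring_def)
    show "\<one> \<in> valuation_ring K v"
      using vgroup.preceq_total[of "one v" "one v"] by (simp add: valuation_ring_def val_one)
    fix x y assume x: "x \<in> valuation_ring K v"
    then show "\<ominus> x \<in> valuation_ring K v"
      using val_minus[of x] by (auto simp: valuation_ring_def)
    assume y: "y \<in> valuation_ring K v"
    show "x \<otimes> y \<in> valuation_ring K v"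
      using x y one_le_mult[of "val v x" "val v y"] val_carrier[of x] val_carrier[of y] val_mult[of x y]
      by (cases "x = \<zero> \<or> y = \<zero>") (auto simp: valuation_ring_def)
    show "x \<oplus> y \<in> valuation_ring K v"
    proof (cases "x = \<zero> \<or> y = \<zero> \<or> x \<oplus> y = \<zero>")
      case True
      then show ?thesis using x y by (auto simp: valuation_ring_def)
    next
      case False
      then have c: "x \<in> carrier K" "y \<in> carrier K" "one v \<preceq>\<^bsub>v\<^esub> val v x" "one v \<preceq>\<^bsub>v\<^esub> val v y"
        using x y by (auto simp: valuation_ring_def)
      then have cs: "val v x \<in> carrier v" "val v y \<in> carrier v" "val v (x \<oplus> y) \<in> carrier v"
        using False val_carrier by auto
      have "val v x \<preceq>\<^bsub>v\<^esub> val v (x \<oplus> y) \<or> val v y \<preceq>\<^bsub>v\<^esub> val v (x \<oplus> y)"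
        using val_add[of x y] False c by simp
      then have "one v \<preceq>\<^bsub>v\<^esub> val v (x \<oplus> y)"
        using vgroup.preceq_trans[OF vgroup.one_closed cs(1,3) c(3)]
          vgroup.preceq_trans[OF vgroup.one_closed cs(2,3) c(4)] by blast
      then show ?thesis using c by (simp add: valuation_ring_def)
    qed
  qed
  fix x assume x: "x \<in> carrier K" "x \<noteq> \<zero>"
  show "x \<in> valuation_ring K v \<or> inv x \<in> valuation_ring K v"
  proof -
    note ix = inv_val[OF x]
    have c: "val v x \<in> carrier v" "val v (inv x) \<in> carrier v"
      using val_carrier x ix by auto
    have "one v \<preceq>\<^bsub>v\<^esub> val v (inv x) \<longleftrightarrow> val v x \<preceq>\<^bsub>v\<^esub> one v"
      using inverse_le[OF c(2,1)] ix(3) vgroup.m_comm[OF c] by simp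
    then show ?thesis
      using vgroup.preceq_total[OF vgroup.one_closed c(1)] x(1) ix(1)
      by (simp add: valuation_ring_def) blast
  qed
qed

lemma valuation_ideal_eq_max_ideal:
  "valuation_ideal K v = valuation_ring_of_field.max_ideal K (valuation_ring K v)"
proof -
  interpret A: valuation_ring_of_field K "valuation_ring K v" by (rule valuation_ring_of_field)
  have *: "val v x = one v \<longleftrightarrow> inv x \<in> valuation_ring K v"
    if x: "x \<in> carrier K" "x \<noteq> \<zero>" "one v \<preceq>\<^bsub>v\<^esub> val v x" for x
  proof -
    note ix = inv_val[OF x(1,2)]
    have c: "val v x \<in> carrier v" "val v (inv x) \<in> carrier v"
      using val_carrier x ix by auto
    have "inv x \<in> valuation_ring K v \<longleftrightarrow> val v x \<preceq>\<^bsub>v\<^esub> one v"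
      using inverse_le[OF c(2,1)] ix vgroup.m_comm[OF c] by (simp add: valuation_ring_def)
    also have "\<dots> \<longleftrightarrow> val v x = one v"
      using vgroup.preceq_antisym[OF c(1) vgroup.one_closed] x(3) by auto
    finally show ?thesis ..
  qed
  have "x \<in> valuation_ideal K v \<longleftrightarrow> x \<in> A.max_ideal" for x
  proof -
    have "x \<in> valuation_ring K v \<longleftrightarrow> x \<in> carrier K \<and> (x = \<zero> \<or> one v \<preceq>\<^bsub>v\<^esub> val v x)"
      by (simp add: valuation_ring_def)
    moreover have "x \<in> valuation_ideal K v \<longleftrightarrow>
        x \<in> carrier K \<and> (x = \<zero> \<or> (one v \<preceq>\<^bsub>v\<^esub> val v x \<and> val v x \<noteq> one v))"
      by (simp add: valuation_ideal_def)
    ultimately show ?thesis using *[of x] A.max_ideal_iff[of x] by blast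
  qed
  then show ?thesis by blast
qed

end

section \<open>The valued field\<close>

definition type_ring :: "'k::field set \<Rightarrow> 'k ring" where
  "type_ring C = \<lparr>carrier = C, monoid.mult = (*), one = 1, ring.zero = 0, ring.add = (+)\<rparr>"

lemma field_type_ring:
  assumes "1 \<in> C" "\<And>x. x \<in> C \<Longrightarrow> - x \<in> C" "\<And>x. x \<in> C \<Longrightarrow> inverse x \<in> C"
    and "\<And>x y. x \<in> C \<Longrightarrow> y \<in> C \<Longrightarrow> x + y \<in> C" "\<And>x y. x \<in> C \<Longrightarrow> y \<in> C \<Longrightarrow> x * y \<in> C"
  shows "field (type_ring C)"
proof -
  have zero: "0 \<in> C" using assms(4)[OF assms(1) assms(2)[OF assms(1)]] by simp
  have "cring (type_ring C)"
  proof (rule cringI)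
    show "abelian_group (type_ring C)"
    proof (rule abelian_groupI)
      fix x assume "x \<in> carrier (type_ring C)"
      then show "\<exists>z\<in>carrier (type_ring C). z \<oplus>\<^bsub>type_ring C\<^esub> x = \<zero>\<^bsub>type_ring C\<^esub>"
        using assms(2)[of x] by (intro bexI[of _ "- x"]) (simp_all add: type_ring_def)
    qed (use assms(4) zero in \<open>simp_all add: type_ring_def add_ac\<close>)
    show "Group.comm_monoid (type_ring C)"
      by (rule comm_monoidI) (use assms in \<open>simp_all add: type_ring_def mult_ac\<close>)
  qed (simp add: type_ring_def distrib_right)
  then show ?thesis
  proof (rule cring.cring_fieldI)
    have "x \<in> Units (type_ring C)" if "x \<in> C" "x \<noteq> 0" for x
      unfolding Units_def type_ring_def using that assms(3)[of x]
      by (auto intro!: bexI[of _ "inverse x"])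
    moreover have "0 \<notin> Units (type_ring C)" by (simp add: Units_def type_ring_def)
    ultimately show "Units (type_ring C) = carrier (type_ring C) - {\<zero>\<^bsub>type_ring C\<^esub>}"
      by (auto simp: type_ring_def Units_def)
  qed
qed

text \<open>
  \<open>\<iota>\<close> is a mere injection of sets; the ring structure on its image is the one transported from \<open>K\<close>.
\<close>

locale embedded_tower = valued_tower_limit V L t y
  for V :: "'k::alg_closed_field set" and L t y +
  fixes \<iota> :: "'k \<Rightarrow> 'c"
  assumes inj: "inj_on \<iota> K"
begin

definition F :: "'c ring" where
  "F = image_ring \<iota> (type_ring K)"

lemma carrier_F: "carrier F = \<iota> ` K"
  by (simp add: F_def image_ring_carrier type_ring_def)

lemma F_simps:
  "\<one>\<^bsub>F\<^esub> = \<iota> 1" "\<zero>\<^bsub>F\<^esub> = \<iota> 0"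
  "a \<in> K \<Longrightarrow> b \<in> K \<Longrightarrow> \<iota> a \<otimes>\<^bsub>F\<^esub> \<iota> b = \<iota> (a * b)"
  "a \<in> K \<Longrightarrow> b \<in> K \<Longrightarrow> \<iota> a \<oplus>\<^bsub>F\<^esub> \<iota> b = \<iota> (a + b)"
  using inj by (simp_all add: F_def image_ring_def image_group_def type_ring_def monoid.defs ring.defs)

lemma K_one: "1 \<in> K" and K_zero: "0 \<in> K"
  using L_subset_K L.one_mem L.zero_mem by auto

lemma K_diff: "a \<in> K \<Longrightarrow> b \<in> K \<Longrightarrow> a - b \<in> K"
  using K_add[of a "- b"] K_uminus[of b] by simp

lemma K_divide: "a \<in> K \<Longrightarrow> b \<in> K \<Longrightarrow> a / b \<in> K"
  by (simp add: divide_inverse K_mult K_inverse)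

lemma t_K: "t n \<in> K"
  by (rule L_subset_K[OF t_union])

lemma field_F: "field F"
proof -
  have "field (type_ring K)"
    by (rule field_type_ring) (auto intro: K_one K_uminus K_inverse K_add K_mult)
  then show ?thesis
    unfolding F_def by (rule field.inj_imp_image_ring_is_field) (simp add: type_ring_def inj)
qed

sublocale F: field F
  by (rule field_F)

sublocale \<iota>: partial_ring_hom F K \<iota>
  by (intro partial_ring_hom.intro partial_ring_hom_axioms.intro F.ring_axioms)
    (auto simp: F_simps carrier_F intro: K_zero K_one K_add K_mult)

lemma iota_eq_zero_iff: "a \<in> K \<Longrightarrow> \<iota> a = \<zero>\<^bsub>F\<^esub> \<longleftrightarrow> a = 0"
  using inj K_zero by (auto simp: F_simps dest: inj_onD)

lemma iota_mem_iff: "a \<in> K \<Longrightarrow> S \<subseteq> K \<Longrightarrow> \<iota> a \<in> \<iota> ` S \<longleftrightarrow> a \<in> S"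
  using inj by (meson inj_on_image_mem_iff)

lemma iota_inv:
  assumes "a \<in> K" "a \<noteq> 0"
  shows "inv\<^bsub>F\<^esub> (\<iota> a) = \<iota> (inverse a)"
  using assms K_inverse[of a]
  by (intro F.comm_inv_char) (auto simp: carrier_F F_simps)

lemma iota_diff: "a \<in> K \<Longrightarrow> b \<in> K \<Longrightarrow> \<iota> a \<ominus>\<^bsub>F\<^esub> \<iota> b = \<iota> (a - b)"
  using \<iota>.map_diff K_diff by simp

definition A :: "'c set" where
  "A = \<iota> ` (K \<inter> V)"

lemma iota_mem_A: "a \<in> K \<Longrightarrow> \<iota> a \<in> A \<longleftrightarrow> a \<in> V"
  unfolding A_def by (subst iota_mem_iff) auto

lemma valuation_ring_A: "valuation_ring_of_field F A"
proof (intro valuation_ring_of_field.intro valuation_ring_of_field_axioms.intro field_F)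
  show "subring A F"
  proof (rule F.subringI)
    show "A \<subseteq> carrier F" by (auto simp: A_def carrier_F)
    show "\<one>\<^bsub>F\<^esub> \<in> A" using K_one one_mem by (auto simp: A_def F_simps)
    fix g h assume "g \<in> A"
    then obtain a where a: "a \<in> K" "a \<in> V" "g = \<iota> a" by (auto simp: A_def)
    have "\<ominus>\<^bsub>F\<^esub> g = \<iota> (- a)"
      using a K_uminus[of a] by (intro F.minus_equality) (auto simp: carrier_F F_simps)
    then show "\<ominus>\<^bsub>F\<^esub> g \<in> A" using a K_uminus uminus_mem by (simp add: iota_mem_A)
    assume "h \<in> A"
    then obtain b where b: "b \<in> K" "b \<in> V" "h = \<iota> b" by (auto simp: A_def)
    show "g \<otimes>\<^bsub>F\<^esub> h \<in> A" "g \<oplus>\<^bsub>F\<^esub> h \<in> A"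
      using a b by (simp_all add: F_simps iota_mem_A K_mult K_add add_mem mult_mem)
  qed
  fix g assume "g \<in> carrier F" "g \<noteq> \<zero>\<^bsub>F\<^esub>"
  then obtain a where "a \<in> K" "a \<noteq> 0" "g = \<iota> a" by (auto simp: carrier_F iota_eq_zero_iff)
  then show "g \<in> A \<or> inv\<^bsub>F\<^esub> g \<in> A"
    using mem_or_inverse_mem[of a] by (simp add: iota_inv iota_mem_A K_inverse)
qed

sublocale A: valuation_ring_of_field F A
  by (rule valuation_ring_A)

lemma iota_mem_max_ideal: "a \<in> K \<Longrightarrow> \<iota> a \<in> A.max_ideal \<longleftrightarrow> a \<in> nonunits"
  using nonunits_subset[of a]
  by (cases "a = 0")
    (auto simp: A.max_ideal_iff iota_eq_zero_iff iota_mem_A iota_inv K_inverse nonunits_def zero_mem)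

abbreviation v :: "('c, 'c set) valuation" where
  "v \<equiv> valuation_of_ring F A"

abbreviation vl :: "'k \<Rightarrow> 'c set" where
  "vl a \<equiv> val v (\<iota> a)"

lemma vl_le_iff:
  "a \<in> K \<Longrightarrow> a \<noteq> 0 \<Longrightarrow> b \<in> K \<Longrightarrow> b \<noteq> 0 \<Longrightarrow> vl a \<preceq>\<^bsub>v\<^esub> vl b \<longleftrightarrow> b / a \<in> V"
  using A.val_le_iff[of "\<iota> a" "\<iota> b"]
  by (simp add: carrier_F iota_eq_zero_iff iota_inv F_simps(3) K_inverse iota_mem_A K_mult divide_inverse)

lemma carrier_v: "carrier v = vl ` (K - {0})"
  by (auto elim!: A.val_carrierE simp: carrier_F iota_eq_zero_iff intro!: A.val_carrier)

lemma value_group_v: "value_group F v = v"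
proof -
  have "val v ` (carrier F - {\<zero>\<^bsub>F\<^esub>}) = carrier v"
    unfolding carrier_v by (force simp: carrier_F iota_eq_zero_iff)
  then show ?thesis by (simp add: value_group_def)
qed

lemma vl_mult:
  "a \<in> K \<Longrightarrow> a \<noteq> 0 \<Longrightarrow> b \<in> K \<Longrightarrow> b \<noteq> 0 \<Longrightarrow> vl a \<otimes>\<^bsub>v\<^esub> vl b = vl (a * b)"
  using A.val_mult[of "\<iota> a" "\<iota> b"] by (simp add: carrier_F iota_eq_zero_iff F_simps(3))

lemma vl_one: "\<one>\<^bsub>v\<^esub> = vl 1"
  by (simp add: A.one_vA F_simps)

lemma vl_inv:
  assumes "a \<in> K" "a \<noteq> 0"
  shows "inv\<^bsub>v\<^esub> (vl a) = vl (inverse a)"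
proof -
  interpret v: comm_group v by (rule A.comm_group_vA)
  show ?thesis
    using assms K_inverse[of a]
    by (intro v.comm_inv_char) (auto simp: carrier_v vl_mult vl_one)
qed

text \<open>
  A proper convex subgroup \<open>H\<close> misses the value of some \<open>t n\<close>, and so it is properly contained in
  the convex hull \<open>E\<close> of the values of \<open>L (Suc n)\<close>, which in turn misses the value of \<open>t (Suc n)\<close>.
\<close>

lemma no_maximal_proper_convex_subgroup:
  "\<not> maximal_proper_convex_subgroup H (value_group F v)"
proof
  assume "maximal_proper_convex_subgroup H (value_group F v)"
  then have sub: "subgroup H v"
    and conv: "\<And>a b x. a \<in> H \<Longrightarrow> b \<in> H \<Longrightarrow> x \<in> carrier v \<Longrightarrow> a \<preceq>\<^bsub>v\<^esub> x \<Longrightarrow> x \<preceq>\<^bsub>v\<^esub> b \<Longrightarrow> x \<in> H"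
    and proper: "H \<noteq> carrier v"
    and maximal: "\<And>H'. convex_subgroup H' v \<Longrightarrow> H' \<noteq> carrier v \<Longrightarrow> H \<subseteq> H' \<Longrightarrow> H' = H"
    unfolding maximal_proper_convex_subgroup_def convex_subgroup_def value_group_v by blast+
  interpret v: comm_group v by (rule A.comm_group_vA)
  have H_sub: "H \<subseteq> carrier v" by (rule subgroup.subset[OF sub])
  have H_one: "vl 1 \<in> H" using subgroup.one_closed[OF sub] by (simp add: vl_one)
  have H_inv: "vl (inverse a) \<in> H" if "a \<in> K" "a \<noteq> 0" "vl a \<in> H" for a
    using subgroup.m_inv_closed[OF sub that(3)] vl_inv[OF that(1,2)] by simp
  have convK: "vl x \<in> H"
    if "vl a \<in> H" "vl b \<in> H" "x / a \<in> V" "b / x \<in> V" "a \<in> K" "a \<noteq> 0" "b \<in> K" "b \<noteq> 0" "x \<in> K" "x \<noteq> 0"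
    for a b x
    using conv[OF that(1,2), of "vl x"] that by (simp add: vl_le_iff carrier_v)
  obtain x where x: "x \<in> K" "x \<noteq> 0" "vl x \<notin> H"
    using proper H_sub carrier_v by auto
  \<comment> \<open>By cofinality, some \<open>t n\<close> has a value above that of \<open>x\<close> or of its inverse, whichever is integral.\<close>
  have "\<exists>n. vl (t n) \<notin> H"
  proof (cases "x \<in> V")
    case True
    obtain n where "t n / x \<in> V" using K_bounded_below[OF x(1)] by blast
    then have "vl (t n) \<notin> H"
      using convK[of 1 "t n" x] H_one True x K_one t_K t_nonzero by auto
    then show ?thesis ..
  next
    case False
    then have ix: "inverse x \<in> V" "inverse x \<in> K" "inverse x \<noteq> 0" "vl (inverse x) \<notin> H"
      using mem_or_inverse_mem x K_inverse H_inv[of "inverse x"] by auto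
    obtain n where "t n / inverse x \<in> V" using K_bounded_below[OF ix(2)] by blast
    then have "vl (t n) \<notin> H"
      using convK[of 1 "t n" "inverse x"] H_one ix K_one t_K t_nonzero by auto
    then show ?thesis ..
  qed
  then obtain n where n: "vl (t n) \<notin> H" ..
  interpret Ln: alg_closed_subfield "L (Suc n)" by (rule subfield_L)
  \<comment> \<open>Taking the bounds from \<open>V\<close> makes a product of two of them a common bound.\<close>
  define B where "B = {b \<in> L (Suc n) \<inter> V. b \<noteq> 0}"
  have B_mult: "b * c \<in> B" if "b \<in> B" "c \<in> B" for b c
    using that by (auto simp: B_def Ln.mult_mem mult_mem)
  define E where "E = {x \<in> K. x \<noteq> 0 \<and> (\<exists>b\<in>B. b / x \<in> V \<and> b * x \<in> V)}"
  have E_convex: "x \<in> E" if "a \<in> E" "c \<in> E" "x / a \<in> V" "c / x \<in> V" "x \<in> K" "x \<noteq> 0" for a c x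
  proof -
    from \<open>a \<in> E\<close> \<open>c \<in> E\<close>
    obtain b d where b: "b \<in> B" "b * a \<in> V" and d: "d \<in> B" "d / c \<in> V" and nz: "a \<noteq> 0" "c \<noteq> 0"
      by (auto simp: E_def)
    have bd: "b \<in> V" "d \<in> V" using b d by (auto simp: B_def)
    have eq: "b * ((d / c) * (c / x)) = b * d / x" "d * ((b * a) * (x / a)) = b * d * x"
      using nz by simp_all
    have "b * d / x \<in> V" "b * d * x \<in> V"
      unfolding eq[symmetric] by (intro mult_mem bd b(2) d(2) that)+
    then show ?thesis using that(5,6) B_mult[OF b(1) d(1)] by (auto simp: E_def)
  qed
  have E_iff: "vl x \<in> vl ` E \<longleftrightarrow> x \<in> E" if x: "x \<in> K" "x \<noteq> 0" for x
  proof
    assume "vl x \<in> vl ` E"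
    then obtain a where a: "a \<in> E" "vl x = vl a" by blast
    have aK: "a \<in> K" "a \<noteq> 0" using a by (auto simp: E_def)
    have "x / a \<in> V" "a / x \<in> V"
      using vl_le_iff[OF aK x] vl_le_iff[OF x aK] vl_le_iff[OF x x] a(2) one_mem x by simp_all
    then show "x \<in> E" using E_convex[OF a(1) a(1)] x by blast
  qed simp
  have "convex_subgroup (vl ` E) v"
    unfolding convex_subgroup_def
  proof (intro conjI ballI impI)
    show "subgroup (vl ` E) v"
    proof (rule v.subgroupI)
      show "vl ` E \<subseteq> carrier v" by (auto simp: E_def carrier_v)
      have "1 \<in> E" using K_one one_mem Ln.one_mem by (auto simp: E_def B_def)
      then show "vl ` E \<noteq> {}" by blast
      fix g h assume "g \<in> vl ` E"
      then obtain a b where a: "a \<in> K" "a \<noteq> 0" "g = vl a" and b: "b \<in> B" "b / a \<in> V" "b * a \<in> V"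
        by (auto simp: E_def)
      have "inverse a \<in> E" using a b K_inverse by (auto simp: E_def field_simps)
      then show "inv\<^bsub>v\<^esub> g \<in> vl ` E" using vl_inv[OF a(1,2)] a(3) by simp
      assume "h \<in> vl ` E"
      then obtain c d where c: "c \<in> K" "c \<noteq> 0" "h = vl c" and d: "d \<in> B" "d / c \<in> V" "d * c \<in> V"
        by (auto simp: E_def)
      have "b * d / (a * c) \<in> V" "b * d * (a * c) \<in> V"
        using mult_mem[OF b(2) d(2)] mult_mem[OF b(3) d(3)] by (simp_all add: mult_ac)
      then have "a * c \<in> E" using a c B_mult[OF b(1) d(1)] K_mult by (auto simp: E_def)
      then show "g \<otimes>\<^bsub>v\<^esub> h \<in> vl ` E" using vl_mult a c by simp
    qed
    fix g h k assume "g \<in> vl ` E" "h \<in> vl ` E" "k \<in> carrier v" and le: "g \<preceq>\<^bsub>v\<^esub> k \<and> k \<preceq>\<^bsub>v\<^esub> h"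
    then obtain a b x where abx: "a \<in> E" "g = vl a" "b \<in> E" "h = vl b" "x \<in> K" "x \<noteq> 0" "k = vl x"
      by (auto simp: carrier_v)
    then have "x / a \<in> V" "b / x \<in> V" using le by (auto simp: vl_le_iff E_def)
    then show "k \<in> vl ` E" using E_convex abx by blast
  qed
  moreover have "t (Suc n) \<notin> E"
  proof
    assume "t (Suc n) \<in> E"
    then obtain b where b: "b \<in> L (Suc n)" "b \<noteq> 0" "b / t (Suc n) \<in> V"
      by (auto simp: E_def B_def)
    then have "t (Suc n) / b \<in> nonunits" by (intro t_div)
    then show False using b t_nonzero[of "Suc n"] by (auto simp: nonunits_def)
  qed
  then have "vl (t (Suc n)) \<in> carrier v - vl ` E"
    using E_iff[of "t (Suc n)"] t_K t_nonzero by (auto simp: carrier_v)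
  then have "vl ` E \<noteq> carrier v" by blast
  moreover have tB: "t n \<in> B"
    using t_mem nonunits_subset[OF t_nonunit] t_nonzero by (auto simp: B_def)
  have "H \<subseteq> vl ` E"
  proof
    fix g assume g: "g \<in> H"
    then obtain x where x: "x \<in> K" "x \<noteq> 0" "g = vl x" using H_sub carrier_v by auto
    have tn: "t n \<in> K" "t n \<noteq> 0" "t n \<in> V" using t_K t_nonzero tB by (auto simp: B_def)
    have *: "t n / x \<in> V" if x: "x \<in> K" "x \<noteq> 0" "vl x \<in> H" for x
    proof (rule ccontr)
      assume "t n / x \<notin> V"
      then have "x / t n \<in> V" using mem_or_inverse_mem[of "t n / x"] by auto
      then show False using n convK[of 1 x "t n"] H_one K_one x tn by auto
    qed
    have "t n / x \<in> V" using * x g by blast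
    moreover have "t n * x \<in> V"
      using *[of "inverse x"] x g H_inv[of x] K_inverse[of x] by (simp add: field_simps)
    ultimately have "x \<in> E" using x tB by (auto simp: E_def)
    then show "g \<in> vl ` E" using x(3) by blast
  qed
  ultimately have "vl ` E = H" by (intro maximal)
  moreover have "t n \<in> E"
    using tB t_K t_nonzero one_mem mult_mem[of "t n" "t n"] by (auto simp: E_def B_def)
  ultimately show False using n by blast
qed

text \<open>
  The polynomial \<open>X\<^sup>2 + X - y\<close> has the simple root \<open>0\<close> modulo the maximal ideal because
  \<open>y = t 0 * (1 + \<dots>)\<close> is a non-unit.
\<close>

lemma not_henselian: "\<not> henselian F v"
proof
  assume "henselian F v"
  then have hensel: "\<And>f a. f \<in> carrier (univ_poly F A) \<Longrightarrow> a \<in> A \<Longrightarrow>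
      F.eval f a \<in> A.max_ideal \<Longrightarrow> F.eval (formal_deriv F f) a \<notin> A.max_ideal \<Longrightarrow>
      \<exists>b\<in>A. F.eval f b = \<zero>\<^bsub>F\<^esub>"
    unfolding henselian_def A.valuation_ring_vA A.valuation_ideal_vA by blast
  have "y = t 0 * (1 + (y - partial_sum 0) / t 0)"
    using t_nonzero[of 0] by (simp add: partial_sum_def field_simps)
  then have y: "y \<in> nonunits"
    using mult_nonunit[OF t_nonunit add_mem[OF one_mem y_limit]] by metis
  define cs where "cs = [1, 1, - y]"
  have cs: "set cs \<subseteq> K" using K_one K_uminus y_mem_K by (simp add: cs_def)
  have p: "poly (list_poly cs) x = x * x + x - y" "poly (pderiv (list_poly cs)) x = 2 * x + 1" for x
    by (simp_all add: cs_def poly_monom pderiv_add pderiv_monom power2_eq_square numeral_2_eq_2)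
  obtain ds where ds: "set ds \<subseteq> K" "formal_deriv F (map \<iota> cs) = map \<iota> ds"
    "list_poly ds = pderiv (list_poly cs)"
    using \<iota>.map_formal_deriv[OF cs] by blast
  have "map \<iota> cs \<in> carrier (univ_poly F A)"
    using K_one K_uminus y_mem_K one_mem uminus_mem nonunits_subset[OF y] iota_eq_zero_iff[OF K_one]
    by (simp add: univ_poly_def polynomial_def cs_def iota_mem_A)
  moreover have "\<iota> 0 \<in> A" using K_zero zero_mem by (simp add: iota_mem_A)
  moreover have "F.eval (map \<iota> cs) (\<iota> 0) \<in> A.max_ideal"
    using \<iota>.map_poly_eval[OF cs K_zero] iota_mem_max_ideal[of "- y"] uminus_nonunit[OF y]
      K_uminus[OF y_mem_K] by (simp add: p)
  moreover have "F.eval (formal_deriv F (map \<iota> cs)) (\<iota> 0) \<notin> A.max_ideal"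
    using \<iota>.map_poly_eval[OF ds(1) K_zero] iota_mem_max_ideal[OF K_one] one_not_nonunit
    by (simp add: p ds)
  ultimately obtain g where "g \<in> A" "F.eval (map \<iota> cs) g = \<zero>\<^bsub>F\<^esub>"
    using hensel by blast
  then obtain b where b: "b \<in> K" "F.eval (map \<iota> cs) (\<iota> b) = \<zero>\<^bsub>F\<^esub>" by (auto simp: A_def)
  then have "b * b + b - y = 0"
    using \<iota>.map_poly_eval[OF cs b(1)] iota_eq_zero_iff[of "b * b + b - y"] by (simp add: p)
  then show False using no_artin_schreier_root[OF b(1)] by simp
qed

text \<open>
  The maximal ideal of \<open>w\<close> contains some \<open>t n\<close>, so by density every integral element of \<open>K\<close> has the
  same residue as an integral element of \<open>L_union\<close>, and polynomials can be lifted.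
\<close>

lemma residue_field_henselian:
  fixes w :: "('c, 'g, 'd) valuation_scheme"
  assumes w: "coarsening F v w" "\<not> trivial_valuation F w"
  shows "henselian (residue_field F w) (residue_valuation F v w)"
proof -
  interpret w: valued_field F w using w(1) by (simp add: coarsening_def)
  define W where "W = valuation_ring F w"
  interpret W: valuation_ring_of_field F W
    unfolding W_def by (rule w.valuation_ring_of_field)
  have AW: "A \<subseteq> W" using w(1) by (simp add: coarsening_def W_def A.valuation_ring_vA)
  have W_ideal: "valuation_ideal F w = W.max_ideal"
    unfolding W_def by (rule w.valuation_ideal_eq_max_ideal)
  have Q: "residue_field F w = W.residue_class_field" "residue_map F w = W.residue"
    by (simp_all add: residue_field_def residue_map_def[abs_def] W_ideal W_def)
  let ?Q = W.residue_class_field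
  interpret Q: valuation_ring_of_field ?Q "W.residue ` A"
    by (rule W.valuation_ring_of_residue_field[OF valuation_ring_A AW])
  have rv: "residue_valuation F v w = Q.vA"
    by (simp add: residue_valuation_def Q A.valuation_ring_vA)
  \<comment> \<open>A non-zero non-unit of \<open>W\<close> exists as \<open>w\<close> is non-trivial, and some \<open>t n\<close> is a multiple of it.\<close>
  obtain n where n: "\<iota> (t n) \<in> W.max_ideal"
  proof -
    obtain g where g: "g \<in> carrier F" "g \<noteq> \<zero>\<^bsub>F\<^esub>" "val w g \<noteq> \<one>\<^bsub>w\<^esub>"
      using w(2) by (auto simp: trivial_valuation_def)
    have "\<exists>h\<in>W.max_ideal. h \<noteq> \<zero>\<^bsub>F\<^esub>"
    proof (cases "g \<in> W")
      case True
      then have "g \<in> valuation_ideal F w"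
        using g by (auto simp: valuation_ideal_def W_def valuation_ring_def)
      then show ?thesis using g(2) W_ideal by blast
    next
      case False
      then have "inv\<^bsub>F\<^esub> g \<in> W" using W.mem_or_inv_mem g by blast
      then show ?thesis
        using False W.inv_nonzero[OF g(1,2)] by (auto simp: W.max_ideal_iff intro!: bexI[of _ "inv\<^bsub>F\<^esub> g"])
    qed
    then obtain h where h: "h \<in> W.max_ideal" "h \<noteq> \<zero>\<^bsub>F\<^esub>" by blast
    then have "h \<in> carrier F" using W.A_carrier by (simp add: W.max_ideal_iff)
    then obtain c where c: "c \<in> K" "c \<noteq> 0" "h = \<iota> c"
      using h(2) by (auto simp: carrier_F iota_eq_zero_iff)
    obtain m where m: "t m / c \<in> V" using K_bounded_below[OF c(1)] by blast
    have "\<iota> (t m / c) \<in> W" using m AW iota_mem_A K_divide[OF t_K c(1)] by blast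
    then have "\<iota> (t m / c) \<otimes>\<^bsub>F\<^esub> \<iota> c \<in> W.max_ideal"
      using W.max_ideal_mult h(1) c(3) by blast
    then show ?thesis using that[of m] c K_divide[OF t_K c(1)] by (simp add: F_simps)
  qed
  have near: "\<exists>a\<in>L_union \<inter> V. W.residue (\<iota> a) = W.residue (\<iota> x)" if x: "x \<in> K" "x \<in> V" for x
  proof -
    obtain a where a: "a \<in> L_union" "(x - a) / t n \<in> V"
      using K_approximable[OF x(1)] unfolding approximable_def by blast
    have aK: "a \<in> K" by (rule L_subset_K[OF a(1)])
    have dK: "(x - a) / t n \<in> K" by (intro K_divide K_diff x aK t_K)
    have "x - (x - a) / t n * t n \<in> V"
      by (intro diff_mem mult_mem x a nonunits_subset[OF t_nonunit])
    then have aV: "a \<in> V" using t_nonzero[of n] by simp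
    have "\<iota> ((x - a) / t n) \<in> W" using a(2) AW iota_mem_A[OF dK] by blast
    then have "\<iota> ((x - a) / t n) \<otimes>\<^bsub>F\<^esub> \<iota> (t n) \<in> W.max_ideal"
      by (rule W.max_ideal_mult[OF n])
    then have "\<iota> x \<ominus>\<^bsub>F\<^esub> \<iota> a \<in> W.max_ideal"
      using dK t_K t_nonzero[of n] x aK by (simp add: F_simps iota_diff)
    moreover have "\<iota> x \<in> W" "\<iota> a \<in> W" using AW iota_mem_A x aK aV by blast+
    ultimately have "W.residue (\<iota> x) = W.residue (\<iota> a)" by (simp add: W.residue_eq_iff)
    then show ?thesis using a(1) aV by auto
  qed
  have LK: "a \<in> K" "\<iota> a \<in> A" "\<iota> a \<in> W" if "a \<in> L_union \<inter> V" for a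
    using that L_subset_K iota_mem_A AW by blast+
  have "henselian ?Q Q.vA"
  proof (rule henselian_via_lift[where L = L_union and V = V and \<rho> = "\<lambda>a. W.residue (\<iota> a)"])
    show "valued_field ?Q Q.vA" by (rule Q.valued_field_vA)
    show "valuation_subring V" by (rule valuation_subring_axioms)
    show "alg_closed_subfield L_union" by (rule subfield_L_union)
    show "partial_ring_hom ?Q (L_union \<inter> V) (\<lambda>a. W.residue (\<iota> a))"
    proof (intro partial_ring_hom.intro partial_ring_hom_axioms.intro Q.ring_axioms)
      fix a assume a: "a \<in> L_union \<inter> V"
      show "W.residue (\<iota> a) \<in> carrier ?Q" by (intro W.residue_simps LK a)
      fix b assume b: "b \<in> L_union \<inter> V"
      show "W.residue (\<iota> (a + b)) = W.residue (\<iota> a) \<oplus>\<^bsub>?Q\<^esub> W.residue (\<iota> b)"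
        using W.residue_simps(3)[OF LK(3)[OF a] LK(3)[OF b]] LK(1) a b by (simp add: F_simps)
      show "W.residue (\<iota> (a * b)) = W.residue (\<iota> a) \<otimes>\<^bsub>?Q\<^esub> W.residue (\<iota> b)"
        using W.residue_simps(2)[OF LK(3)[OF a] LK(3)[OF b]] LK(1) a b by (simp add: F_simps)
      show "a + b \<in> L_union \<inter> V" "a * b \<in> L_union \<inter> V"
        using a b L.add_mem L.mult_mem add_mem mult_mem by auto
    next
      show "W.residue (\<iota> 1) = \<one>\<^bsub>?Q\<^esub>" using W.residue_simps(4) by (simp add: F_simps)
    qed (use L.zero_mem L.one_mem zero_mem one_mem in auto)
    show "(\<lambda>a. W.residue (\<iota> a)) ` (L_union \<inter> V) = valuation_ring ?Q Q.vA"
      unfolding Q.valuation_ring_vA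
    proof (intro subset_antisym subsetI)
      fix S assume "S \<in> (\<lambda>a. W.residue (\<iota> a)) ` (L_union \<inter> V)"
      then show "S \<in> W.residue ` A" using LK(2) by blast
    next
      fix S assume "S \<in> W.residue ` A"
      then obtain x where x: "x \<in> K" "x \<in> V" "S = W.residue (\<iota> x)" by (auto simp: A_def)
      then show "S \<in> (\<lambda>a. W.residue (\<iota> a)) ` (L_union \<inter> V)"
        using near[OF x(1,2)] by (metis image_eqI)
    qed
    show "W.residue (\<iota> a) \<in> valuation_ideal ?Q Q.vA \<longleftrightarrow> a \<in> nonunits" if "a \<in> L_union \<inter> V" for a
      unfolding Q.valuation_ideal_vA
      using W.residue_mem_max_ideal_iff[OF valuation_ring_A AW LK(2)[OF that]]
        iota_mem_max_ideal[OF LK(1)[OF that]] by simp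
  qed
  then show ?thesis by (simp add: Q rv)
qed

end

theorem proposition4:
  shows "\<exists>(K :: complex ring) (v :: (complex, complex set) valuation).
    valued_field K v \<and>
    (\<nexists>H. maximal_proper_convex_subgroup H (value_group K v)) \<and>
    (\<forall>w :: (complex, complex set) valuation.
       coarsening K v w \<and> \<not> trivial_valuation K w \<and> \<not> equivalent_valuations K w v \<longrightarrow>
       henselian (residue_field K w) (residue_valuation K v w)) \<and>
    \<not> henselian K v"
proof -
  obtain L t where "valued_tower finite_hyper L t"
    using valued_tower_exists[OF finite_hyper.valuation_subring_axioms finite_hyper_scale] by blast
  then interpret valued_tower finite_hyper L t .
  obtain y where "\<And>n. (y - partial_sum n) / t n \<in> finite_hyper"
    using finite_hyper_pseudo_limit[of t partial_sum] t_nonzero pseudo_cauchy by blast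
  then interpret valued_tower_limit finite_hyper L t y
    by unfold_locales
  define \<iota> :: "hyper \<Rightarrow> complex" where "\<iota> x = of_nat (to_nat_on K x)" for x
  have "inj_on \<iota> K"
    using inj_on_to_nat_on[OF countable_K] by (auto simp: \<iota>_def inj_on_def)
  then interpret embedded_tower finite_hyper L t y \<iota>
    by unfold_locales
  show ?thesis
    using A.valued_field_vA no_maximal_proper_convex_subgroup residue_field_henselian not_henselian
    by blast
qed

end
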